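(* Let $N\in\mathbb{N}$, let $a\in[\pi/(N+1),\pi/N)$ (so $a$ may be any number in $(0,\pi)$), and let $p,q\in L_2(0,\pi)$ be complex-valued functions vanishing a.e. on $(0,a)$. Then for each $j\in\{1,2\}$ the boundary value problem $\mathcal{B}_j(a,p,q)$ has infinitely many eigenvalues, and they can be enumerated (counted with multiplicity) as $\{\lambda_{n,j}\}_{n\in\mathbb{Z}}$ in such a way that $$\lambda_{n,j}=n+\frac{1-j}{2}+o(1),\qquad |n|\to\infty.$$
   Context: For $a\in(0,\pi)$ and complex-valued $p,q\in L_2(0,\pi)$ with $p=q=0$ a.e. on $(0,a)$, and $j\in\{1,2\}$, $\mathcal{B}_j(a,p,q)$ denotes the boundary value problem $$By'(x)+Q(x)y(x-a)=\lambda y(x),\quad 0<x<\pi,\qquad y_1(0)=y_j(\pi)=0,$$ where $$B=\begin{bmatrix}0&1\\ -1&0\end{bmatrix},\quad y(x)=\begin{bmatrix}y_1(x)\\ y_2(x)\end{bmatrix},\quad Q(x)=\begin{bmatrix}p(x)&q(x)\\ q(x)&-p(x)\end{bmatrix}.$$ Since $Q=0$ on $(0,a)$, the term $Q(x)y(x-a)$ is understood to be $0$ for $x<a$. Solutions are absolutely continuous on $[0,\pi]$ and satisfy the equation a.e. Let $S(x,\lambda)=\begin{bmatrix}s_1(x,\lambda)\\ s_2(x,\lambda)\end{bmatrix}$ be the solution of the equation with $S(0,\lambda)=\begin{bmatrix}0\\ -1\end{bmatrix}$. The characteristic function of $\mathcal{B}_j(a,p,q)$ is the entire function $\Delta_j(\lambda)=s_j(\pi,\lambda)$.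 Its zeros are the eigenvalues of $\mathcal{B}_j(a,p,q)$, and the multiplicity of an eigenvalue is its multiplicity as a zero of $\Delta_j$. *)

theory Defs
  imports "HOL-Complex_Analysis.Complex_Analysis" "HOL-Library.Landau_Symbols"
begin

definition square_integrable_on :: "(real \<Rightarrow> complex) \<Rightarrow> real set \<Rightarrow> bool"
    (infix "square'_integrable'_on" 50) where
  "f square_integrable_on S \<longleftrightarrow>
     f \<in> borel_measurable (lebesgue_on S) \<and> integrable (lebesgue_on S) (\<lambda>x. (cmod (f x))\<^sup>2)"

text \<open>The usual \<open>\<epsilon>\<close>-\<open>\<delta>\<close> definition. The finite families of non-overlapping compact subintervals
  \<open>{u..v}\<close> of \<open>S\<close> are the divisions \<open>d\<close> of subsets \<open>T\<close> of \<open>S\<close>; for \<open>K = {u..v}\<close>, \<open>Inf K = u\<close>,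
  \<open>Sup K = v\<close> and \<open>measure lborel K = v - u\<close>. (The library constant \<open>absolutely_continuous\<close>
  is about measures.)\<close>
definition abs_continuous_on :: "real set \<Rightarrow> (real \<Rightarrow> 'a::real_normed_vector) \<Rightarrow> bool" where
  "abs_continuous_on S f \<longleftrightarrow>
     (\<forall>\<epsilon>>0. \<exists>\<delta>>0. \<forall>d T. d division_of T \<and> T \<subseteq> S \<and> (\<Sum>K\<in>d. measure lborel K) < \<delta> \<longrightarrow>
        (\<Sum>K\<in>d. norm (f (Sup K) - f (Inf K))) < \<epsilon>)"

definition matB :: "complex^2^2" where
  "matB = vector [vector [0, 1], vector [-1, 0]]"

definition matQ :: "(real \<Rightarrow> complex) \<Rightarrow> (real \<Rightarrow> complex) \<Rightarrow> real \<Rightarrow> complex^2^2" where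
  "matQ p q x = vector [vector [p x, q x], vector [q x, - p x]]"

text \<open>Solutions on \<open>[0, \<pi>]\<close>. Only the values of \<open>y\<close> on \<open>[0, \<pi>]\<close> matter, since the delayed term
  is \<open>0\<close> for \<open>x < a\<close>.\<close>
definition dirac_solution ::
    "real \<Rightarrow> (real \<Rightarrow> complex) \<Rightarrow> (real \<Rightarrow> complex) \<Rightarrow> complex \<Rightarrow> (real \<Rightarrow> complex^2) \<Rightarrow> bool" where
  "dirac_solution a p q l y \<longleftrightarrow>
     abs_continuous_on {0..pi} y \<and>
     (AE x in lebesgue. 0 < x \<and> x < pi \<longrightarrow>
        (\<exists>y'. (y has_vector_derivative y') (at x) \<and>
              matB *v y' + (if x < a then 0 else matQ p q x *v y (x - a)) = l *s y x))"

text \<open>The index \<open>j \<in> {1, 2}\<close> is a natural number; \<open>of_nat j\<close> is the corresponding element of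
  the index type \<open>2\<close>, so \<open>y x $ of_nat j\<close> is the component \<open>y\<^sub>j(x)\<close>.\<close>
definition eigenvalues ::
    "nat \<Rightarrow> real \<Rightarrow> (real \<Rightarrow> complex) \<Rightarrow> (real \<Rightarrow> complex) \<Rightarrow> complex set" where
  "eigenvalues j a p q =
     {l. \<exists>y. dirac_solution a p q l y \<and> (\<exists>x\<in>{0..pi}. y x \<noteq> 0) \<and>
             y 0 $ 1 = 0 \<and> y pi $ of_nat j = 0}"

text \<open>The solution with this initial value is unique on \<open>[0, \<pi>]\<close>; its values elsewhere are
  irrelevant.\<close>
definition dirac_S ::
    "real \<Rightarrow> (real \<Rightarrow> complex) \<Rightarrow> (real \<Rightarrow> complex) \<Rightarrow> complex \<Rightarrow> real \<Rightarrow> complex^2" where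
  "dirac_S a p q l = (SOME y. dirac_solution a p q l y \<and> y 0 = vector [0, -1])"

definition char_fun ::
    "nat \<Rightarrow> real \<Rightarrow> (real \<Rightarrow> complex) \<Rightarrow> (real \<Rightarrow> complex) \<Rightarrow> complex \<Rightarrow> complex" where
  "char_fun j a p q l = dirac_S a p q l pi $ of_nat j"

text \<open>\<open>ev\<close> lists exactly the eigenvalues, each one as often as its multiplicity as a zero of the
  characteristic function.\<close>
definition enumerates_eigenvalues ::
    "(int \<Rightarrow> complex) \<Rightarrow> nat \<Rightarrow> real \<Rightarrow> (real \<Rightarrow> complex) \<Rightarrow> (real \<Rightarrow> complex) \<Rightarrow> bool" where
  "enumerates_eigenvalues ev j a p q \<longleftrightarrow>
     range ev = eigenvalues j a p q \<and>
     (\<forall>l \<in> eigenvalues j a p q.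
        finite {n. ev n = l} \<and> int (card {n. ev n = l}) = zorder (char_fun j a p q) l)"

end

theory Submission
  imports Defs
begin

text \<open>
  With \<open>u = y\<^sub>1 + i y\<^sub>2\<close> and \<open>v = y\<^sub>1 - i y\<^sub>2\<close> the system becomes \<open>u' = i\<lambda>u + (q - ip) v(x - a)\<close>,
  \<open>v' = -i\<lambda>v + (q + ip) u(x - a)\<close>. The amplitudes \<open>e\<^bsup>-i\<lambda>x\<^esup> u\<close> and \<open>e\<^bsup>i\<lambda>x\<^esup> v\<close> are obtained by iterated
  integration, which is stationary after finitely many steps because of the delay. In each step a
  Riemann-Lebesgue argument for complex \<open>\<lambda>\<close> bounds the correction to \<open>u\<close> and \<open>v\<close> by
  \<open>o(e\<^bsup>|Im \<lambda>| x\<^esup>)\<close>, uniformly in \<open>x\<close>. So \<open>\<Delta>\<^sub>j\<close> differs from \<open>sin \<pi>\<lambda>\<close> or \<open>-cos \<pi>\<lambda>\<close> by \<open>o(e\<^bsup>\<pi>|Im \<lambda>|\<^esup>)\<close>, and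
  Rouche's theorem on one large circle and on small circles outside it locates the zeros.
\<close>

section \<open>Approximation in the mean\<close>

text \<open>Iterated integration yields one explicit solution, but \<open>dirac_S\<close> is chosen
  by its defining property and \<open>eigenvalues\<close> ranges over all solutions. The explicit
  formula therefore has to be paired with uniqueness among absolutely continuous functions. Hence
  the preliminaries: an indefinite integral is absolutely continuous with the expected derivative
  a.e., and an absolutely continuous function with derivative 0 a.e. is constant. Eigenvalues may be
  complex, so the estimates must hold in the whole plane, where solutions grow exponentially. The
  error o(e^(pi |Im \<lambda>|)) is the right scale: at distance at least \<delta> from the
  integers, |sin(pi \<lambda>)| is bounded below by a positive multiple of e^(pi |Im \<lambda>|).
  Exchanging \<open>f\<close> with \<open>g\<close> and \<lambda> with -\<lambda> exchanges the two
  amplitudes, so one recursion and one induction serve both. The shift (1 - j)/2 comes from -cos(pi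
  \<lambda>) = -sin(pi (\<lambda> + 1/2)).\<close>

lemma absolutely_integrable_imp_norm_diff_integrable:
  fixes f g :: "'a::euclidean_space \<Rightarrow> 'b::euclidean_space"
  assumes "f absolutely_integrable_on S" "g absolutely_integrable_on S"
  shows "(\<lambda>x. norm (f x - g x)) integrable_on S"
  using set_integral_diff(1)[OF assms] by (simp add: absolutely_integrable_on_def)

text \<open>Dominated convergence, twice. Truncating \<open>f\<close> to a large ball changes it
  little in the mean; a bounded measurable function is a.e. a limit of continuous functions, and
  these can be truncated to the same ball, so that a constant dominates.\<close>

lemma L1_continuous_approx:
  fixes f :: "real \<Rightarrow> 'a::euclidean_space"
  assumes f: "f absolutely_integrable_on {a..b}" and "e > 0"
  obtains g where "continuous_on UNIV g" "integral {a..b} (\<lambda>x. norm (f x - g x)) < e"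
proof -
  \<comment> \<open>Projection onto the ball of radius \<open>M\<close>: continuous, the identity on
    the ball, and no point \<open>z\<close> moves by more than \<open>norm z\<close>, because 0 lies
    in the ball.\<close>
  define T where "T M = closest_point (cball (0::'a) M)" for M :: real
  have T_cont: "continuous_on UNIV (T M)" if "M \<ge> 0" for M
    unfolding T_def using that by (intro continuous_on_closest_point) auto
  have T_bound: "norm (T M z) \<le> M" if "M \<ge> 0" for M z
    using closest_point_in_set[of "cball (0::'a) M" z] that by (auto simp: T_def)
  have T_self: "T M z = z" if "norm z \<le> M" for M z
    using that by (auto simp: T_def intro!: closest_point_self)
  have T_le: "norm (z - T M z) \<le> norm z" if "M \<ge> 0" for M z
    using closest_point_le[of "cball (0::'a) M" 0 z] that by (auto simp: T_def dist_norm)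
  have fm: "f \<in> borel_measurable (lebesgue_on {a..b})"
    using absolutely_integrable_imp_borel_measurable[OF f] by simp
  have Tf_meas: "(\<lambda>x. T M (f x)) \<in> borel_measurable (lebesgue_on {a..b})" if "M \<ge> 0" for M
    using measurable_comp[OF fm borel_measurable_continuous_onI[OF T_cont[OF that]]] by (simp add: o_def)
  have nf: "(\<lambda>x. norm (f x)) integrable_on {a..b}"
    using f by (simp add: absolutely_integrable_on_def)
  have Tf_int: "(\<lambda>x. T M (f x)) absolutely_integrable_on {a..b}" if "M \<ge> 0" for M
    using Tf_meas[OF that] T_bound[OF that]
    by (intro measurable_bounded_by_integrable_imp_absolutely_integrable[where g = "\<lambda>_. M"]) auto
  have "(\<lambda>k. integral {a..b} (\<lambda>x. norm (f x - T (real k) (f x)))) \<longlonglongrightarrow> integral {a..b} (\<lambda>x. 0)"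
  proof (rule dominated_convergence(2)[OF _ nf])
    show "(\<lambda>x. norm (f x - T (real k) (f x))) integrable_on {a..b}" for k
      by (intro absolutely_integrable_imp_norm_diff_integrable f Tf_int) auto
    show "norm (norm (f x - T (real k) (f x))) \<le> norm (f x)" for k x
      using T_le[of "real k" "f x"] by simp
    show "(\<lambda>k. norm (f x - T (real k) (f x))) \<longlonglongrightarrow> 0" for x
    proof (rule tendsto_eventually)
      obtain k0 :: nat where "norm (f x) \<le> real k0" using real_arch_simple by blast
      then show "\<forall>\<^sub>F k in sequentially. norm (f x - T (real k) (f x)) = 0"
        by (intro eventually_sequentiallyI[of k0]) (auto intro!: T_self[symmetric])
    qed
  qed
  then have "eventually (\<lambda>k. integral {a..b} (\<lambda>x. norm (f x - T (real k) (f x))) < e/2) sequentially"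
    using \<open>e > 0\<close> by (intro order_tendstoD) auto
  then obtain k where k: "integral {a..b} (\<lambda>x. norm (f x - T (real k) (f x))) < e/2"
    using eventually_sequentially by auto
  define M where "M = real k"
  have M: "M \<ge> 0" by (simp add: M_def)
  obtain N g where N: "negligible N" and gc: "\<And>n. continuous_on UNIV (g n)"
    and lim: "\<And>x. x \<notin> N \<Longrightarrow> (\<lambda>n. g n x) \<longlonglongrightarrow> (if x \<in> {a..b} then T M (f x) else 0)"
  proof -
    have "(\<lambda>x. T M (f x)) measurable_on {a..b}"
      using Tf_meas[OF M] by (subst measurable_on_iff_borel_measurable) auto
    then show ?thesis unfolding measurable_on_def using that by auto
  qed
  \<comment> \<open>Truncating the approximants again bounds them by \<open>M\<close> and keeps the
    limit, since \<open>T M\<close> fixes \<open>T M (f x)\<close>.\<close>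
  have h_cont: "continuous_on UNIV (\<lambda>x. T M (g n x))" for n
    using continuous_on_compose2[OF T_cont[OF M] gc] by auto
  have "(\<lambda>n. integral ({a..b} - N) (\<lambda>x. norm (T M (f x) - T M (g n x)))) \<longlonglongrightarrow> integral ({a..b} - N) (\<lambda>x. 0)"
  proof (rule dominated_convergence(2))
    have spike: "h integrable_on {a..b} - N \<longleftrightarrow> h integrable_on {a..b}" for h :: "real \<Rightarrow> real"
      using N by (intro integrable_spike_set_eq negligible_subset[OF N]) auto
    show "(\<lambda>x. norm (T M (f x) - T M (g n x))) integrable_on {a..b} - N" for n
      unfolding spike
      by (intro absolutely_integrable_imp_norm_diff_integrable Tf_int M
        absolutely_integrable_continuous_real continuous_on_subset[OF h_cont subset_UNIV])
    show "(\<lambda>x. 2 * M) integrable_on {a..b} - N" unfolding spike by auto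
    show "norm (norm (T M (f x) - T M (g n x))) \<le> 2 * M" for n x
      using norm_triangle_ineq4[of "T M (f x)" "T M (g n x)"] T_bound[OF M, of "f x"] T_bound[OF M, of "g n x"]
      by simp
    show "(\<lambda>n. norm (T M (f x) - T M (g n x))) \<longlonglongrightarrow> 0" if "x \<in> {a..b} - N" for x
    proof -
      have "(\<lambda>n. T M (g n x)) \<longlonglongrightarrow> T M (T M (f x))"
        using lim[of x] that T_cont[OF M] by (intro isCont_tendsto_compose[of _ "T M"]) (auto simp: continuous_on_eq_continuous_at)
      then have "(\<lambda>n. T M (f x) - T M (g n x)) \<longlonglongrightarrow> T M (f x) - T M (f x)"
        using T_self[OF T_bound[OF M]] by (intro tendsto_intros) auto
      then show ?thesis by (simp add: tendsto_norm_zero_iff)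
    qed
  qed
  moreover have "integral ({a..b} - N) h = integral {a..b} h" for h :: "real \<Rightarrow> real"
    by (intro integral_spike_set negligible_subset[OF N]) auto
  ultimately have "eventually (\<lambda>n. integral {a..b} (\<lambda>x. norm (T M (f x) - T M (g n x))) < e/2) sequentially"
    using \<open>e > 0\<close> by (intro order_tendstoD) auto
  then obtain n where n: "integral {a..b} (\<lambda>x. norm (T M (f x) - T M (g n x))) < e/2"
    using eventually_sequentially by auto
  have gi: "(\<lambda>x. T M (g n x)) absolutely_integrable_on {a..b}"
    by (rule absolutely_integrable_continuous_real[OF continuous_on_subset[OF h_cont subset_UNIV]])
  have i1: "(\<lambda>x. norm (f x - T M (g n x))) integrable_on {a..b}"
   and i2: "(\<lambda>x. norm (f x - T M (f x))) integrable_on {a..b}"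
   and i3: "(\<lambda>x. norm (T M (f x) - T M (g n x))) integrable_on {a..b}"
    by (intro absolutely_integrable_imp_norm_diff_integrable f gi Tf_int M)+
  have "integral {a..b} (\<lambda>x. norm (f x - T M (g n x)))
     \<le> integral {a..b} (\<lambda>x. norm (f x - T M (f x)) + norm (T M (f x) - T M (g n x)))"
    by (intro integral_le i1 integrable_add i2 i3) (metis diff_add_cancel add_diff_eq norm_triangle_ineq)
  also have "\<dots> < e" using k n Henstock_Kurzweil_Integration.integral_add[OF i2 i3] by (simp add: M_def)
  finally show ?thesis using that h_cont by blast
qed

text \<open>Polynomials are bounded on the interval, which serves the absolute continuity of
  integrals, and continuously differentiable, which serves the integration by parts in
  \<open>riemann_lebesgue_exp\<close>.\<close>

lemma L1_polynomial_approx: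
  fixes f :: "real \<Rightarrow> 'a::euclidean_space"
  assumes f: "f absolutely_integrable_on {a..b}" and "e > 0"
  obtains g where "polynomial_function g" "integral {a..b} (\<lambda>x. norm (f x - g x)) < e"
proof -
  obtain h where h: "continuous_on UNIV h" "integral {a..b} (\<lambda>x. norm (f x - h x)) < e/2"
    using L1_continuous_approx[OF f, of "e/2"] \<open>e > 0\<close> by auto
  \<comment> \<open>The summand 1 keeps the divisor in \<open>\<eta>\<close> positive when the
    interval is a point.\<close>
  define c where "c = \<bar>b - a\<bar> + 1"
  define \<eta> where "\<eta> = e / (2 * c)"
  have "c > 0" using abs_ge_zero[of "b - a"] unfolding c_def by linarith
  then have \<eta>: "\<eta> > 0" using \<open>e > 0\<close> by (auto simp: \<eta>_def intro!: divide_pos_pos mult_pos_pos)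
  obtain g where g: "polynomial_function g" "\<And>x. x \<in> {a..b} \<Longrightarrow> norm (h x - g x) < \<eta>"
    using Stone_Weierstrass_polynomial_function[of "{a..b}" h \<eta>] h(1) \<eta>
    by (metis compact_Icc continuous_on_subset subset_UNIV)
  have hi: "h absolutely_integrable_on {a..b}" and gi: "g absolutely_integrable_on {a..b}"
    using h(1) g(1) by (auto intro!: absolutely_integrable_continuous_real intro: continuous_on_subset
      continuous_on_polymonial_function)
  have i: "(\<lambda>x. norm (f x - g x)) integrable_on {a..b}" "(\<lambda>x. norm (f x - h x)) integrable_on {a..b}"
    by (intro absolutely_integrable_imp_norm_diff_integrable f gi hi)+
  have "integral {a..b} (\<lambda>x. norm (f x - g x)) \<le> integral {a..b} (\<lambda>x. norm (f x - h x) + \<eta>)"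
  proof (intro integral_le i integrable_add)
    fix x assume "x \<in> {a..b}"
    then show "norm (f x - g x) \<le> norm (f x - h x) + \<eta>"
      using norm_triangle_ineq[of "f x - h x" "h x - g x"] g(2)[of x] by simp
  qed auto
  also have "\<dots> \<le> integral {a..b} (\<lambda>x. norm (f x - h x)) + \<bar>b - a\<bar> * \<eta>"
    using \<eta> by (subst Henstock_Kurzweil_Integration.integral_add) (auto simp: i abs_if mult.commute)
  also have "\<dots> < e"
  proof -
    have "c * \<eta> = e/2" using \<open>c > 0\<close> by (simp add: \<eta>_def)
    then have "\<bar>b - a\<bar> * \<eta> \<le> e/2" using \<eta> by (simp add: c_def algebra_simps)
    then show ?thesis using h(2) by linarith
  qed
  finally show ?thesis using that g(1) by blast
qed

section \<open>Absolutely continuous functions\<close>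

lemma division_of_realE:
  fixes K :: "real set"
  assumes "d division_of T" "T \<subseteq> S" "K \<in> d"
  obtains u v where "K = {u..v}" "u \<le> v" "{u..v} \<subseteq> S" "Inf K = u" "Sup K = v" "measure lborel K = v - u"
proof -
  obtain u v where "K = cbox u v" "K \<noteq> {}" "K \<subseteq> T"
    using division_ofD(2-4)[OF assms(1) assms(3)] by blast
  then show ?thesis using that[of u v] assms(2) by auto
qed

lemma abs_continuous_onD:
  assumes "abs_continuous_on S f" "e > 0"
  shows "\<exists>\<delta>>0. \<forall>d T. d division_of T \<longrightarrow> T \<subseteq> S \<longrightarrow>
      (\<Sum>K\<in>d. measure lborel K) < \<delta> \<longrightarrow> (\<Sum>K\<in>d. norm (f (Sup K) - f (Inf K))) < e"
  using assms(1)[unfolded abs_continuous_on_def, rule_format, OF assms(2)] by (simp only: imp_conjL)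

lemma abs_continuous_on_subset:
  "abs_continuous_on S f \<Longrightarrow> T \<subseteq> S \<Longrightarrow> abs_continuous_on T f"
  unfolding abs_continuous_on_def by (meson order_trans)

lemma abs_continuous_on_cong:
  assumes "\<And>x. x \<in> S \<Longrightarrow> f x = g x"
  shows "abs_continuous_on S f \<longleftrightarrow> abs_continuous_on S g"
proof -
  have "(\<Sum>K\<in>d. norm (f (Sup K) - f (Inf K))) = (\<Sum>K\<in>d. norm (g (Sup K) - g (Inf K)))"
    if "d division_of T" "T \<subseteq> S" for d T
  proof (rule sum.cong)
    fix K assume "K \<in> d"
    from division_of_realE[OF that this]
    obtain u v where "u \<le> v" "{u..v} \<subseteq> S" "Inf K = u" "Sup K = v" by metis
    moreover from this have "u \<in> S" "v \<in> S" by auto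
    ultimately show "norm (f (Sup K) - f (Inf K)) = norm (g (Sup K) - g (Inf K))"
      using assms by simp
  qed simp
  then show ?thesis unfolding abs_continuous_on_def by (metis (no_types, lifting))
qed

lemma abs_continuous_on_imp_continuous_on:
  assumes "abs_continuous_on {a..b} f"
  shows "continuous_on {a..b} f"
  unfolding continuous_on_iff
proof (intro ballI allI impI)
  fix x e assume x: "x \<in> {a..b}" and "(e::real) > 0"
  from abs_continuous_onD[OF assms \<open>e > 0\<close>]
  obtain \<delta> where "\<delta> > 0" and \<delta>: "\<forall>d T. d division_of T \<longrightarrow> T \<subseteq> {a..b} \<longrightarrow>
      (\<Sum>K\<in>d. measure lborel K) < \<delta> \<longrightarrow> (\<Sum>K\<in>d. norm (f (Sup K) - f (Inf K))) < e"
    by (elim exE conjE) (rule that)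
  note \<delta> = \<delta>[rule_format]
  have *: "norm (f v - f u) < e" if "u \<le> v" "a \<le> u" "v \<le> b" "v - u < \<delta>" for u v
  proof -
    \<comment> \<open>Divisions with one member already give uniform continuity.\<close>
    have "{{u..v}} division_of {u..v}"
      using division_of_self[of u v] that(1) by simp
    then have "(\<Sum>K\<in>{{u..v}}. norm (f (Sup K) - f (Inf K))) < e"
      by (rule \<delta>) (use that in auto)
    then show ?thesis using that(1) by simp
  qed
  have "dist (f y) (f x) < e" if y: "y \<in> {a..b}" "dist y x < \<delta>" for y
    using *[of x y] *[of y x] x y by (cases "x \<le> y") (auto simp: dist_norm norm_minus_commute)
  with \<open>\<delta> > 0\<close> show "\<exists>d>0. \<forall>x'\<in>{a..b}. dist x' x < d \<longrightarrow> dist (f x') (f x) < e" by blast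
qed

lemma abs_continuous_on_const: "abs_continuous_on S (\<lambda>x. c)"
  unfolding abs_continuous_on_def by (auto intro: exI[of _ 1])

lemma abs_continuous_on_bounded_linear:
  assumes f: "abs_continuous_on S f" and L: "bounded_linear L"
  shows "abs_continuous_on S (\<lambda>x. L (f x))"
  unfolding abs_continuous_on_def
proof (intro allI impI)
  fix e :: real assume "e > 0"
  obtain B where "B > 0" and B: "\<And>x. norm (L x) \<le> norm x * B"
    using bounded_linear.pos_bounded[OF L] by blast
  have "e / B > 0" using \<open>e > 0\<close> \<open>B > 0\<close> by simp
  from abs_continuous_onD[OF f this]
  obtain \<delta> where "\<delta> > 0" and \<delta>: "\<forall>d T. d division_of T \<longrightarrow> T \<subseteq> S \<longrightarrow>
      (\<Sum>K\<in>d. measure lborel K) < \<delta> \<longrightarrow> (\<Sum>K\<in>d. norm (f (Sup K) - f (Inf K))) < e / B"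
    by (elim exE conjE) (rule that)
  note \<delta> = \<delta>[rule_format]
  have "(\<Sum>K\<in>d. norm (L (f (Sup K)) - L (f (Inf K)))) < e"
    if "d division_of T" "T \<subseteq> S" "(\<Sum>K\<in>d. measure lborel K) < \<delta>" for d T
  proof -
    have "(\<Sum>K\<in>d. norm (L (f (Sup K)) - L (f (Inf K)))) \<le> (\<Sum>K\<in>d. norm (f (Sup K) - f (Inf K))) * B"
      unfolding sum_distrib_right
      by (intro sum_mono) (metis B L bounded_linear.linear linear_diff)
    also have "\<dots> < e" using \<delta>[OF that] \<open>B > 0\<close> by (simp add: field_simps)
    finally show ?thesis .
  qed
  with \<open>\<delta> > 0\<close> show "\<exists>\<delta>>0. \<forall>d T. d division_of T \<and> T \<subseteq> S \<and> (\<Sum>K\<in>d. measure lborel K) < \<delta> \<longrightarrow>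
        (\<Sum>K\<in>d. norm (L (f (Sup K)) - L (f (Inf K)))) < e" by blast
qed

lemma abs_continuous_on_mult:
  fixes f g :: "real \<Rightarrow> 'a::real_normed_algebra"
  assumes f: "abs_continuous_on {a..b} f" and g: "abs_continuous_on {a..b} g"
  shows "abs_continuous_on {a..b} (\<lambda>x. f x * g x)"
  unfolding abs_continuous_on_def
proof (intro allI impI)
  fix e :: real assume "e > 0"
  have "bounded (f ` {a..b})" "bounded (g ` {a..b})"
    by (intro compact_imp_bounded compact_continuous_image abs_continuous_on_imp_continuous_on f g; simp)+
  then obtain A B where "A > 0" "B > 0" and A: "\<And>x. x \<in> {a..b} \<Longrightarrow> norm (f x) \<le> A"
      and B: "\<And>x. x \<in> {a..b} \<Longrightarrow> norm (g x) \<le> B"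
    unfolding bounded_pos by (metis image_eqI)
  have "e / (2 * B) > 0" using \<open>e > 0\<close> \<open>B > 0\<close> by simp
  from abs_continuous_onD[OF f this]
  obtain \<delta>1 where "\<delta>1 > 0" and \<delta>1: "\<forall>d T. d division_of T \<longrightarrow> T \<subseteq> {a..b} \<longrightarrow>
      (\<Sum>K\<in>d. measure lborel K) < \<delta>1 \<longrightarrow> (\<Sum>K\<in>d. norm (f (Sup K) - f (Inf K))) < e / (2 * B)"
    by (elim exE conjE) (rule that)
  note \<delta>1 = \<delta>1[rule_format]
  have "e / (2 * A) > 0" using \<open>e > 0\<close> \<open>A > 0\<close> by simp
  from abs_continuous_onD[OF g this]
  obtain \<delta>2 where "\<delta>2 > 0" and \<delta>2: "\<forall>d T. d division_of T \<longrightarrow> T \<subseteq> {a..b} \<longrightarrow>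
      (\<Sum>K\<in>d. measure lborel K) < \<delta>2 \<longrightarrow> (\<Sum>K\<in>d. norm (g (Sup K) - g (Inf K))) < e / (2 * A)"
    by (elim exE conjE) (rule that)
  note \<delta>2 = \<delta>2[rule_format]
  have "(\<Sum>K\<in>d. norm (f (Sup K) * g (Sup K) - f (Inf K) * g (Inf K))) < e"
    if d: "d division_of T" "T \<subseteq> {a..b}" "(\<Sum>K\<in>d. measure lborel K) < min \<delta>1 \<delta>2" for d T
  proof -
    have "(\<Sum>K\<in>d. norm (f (Sup K) * g (Sup K) - f (Inf K) * g (Inf K)))
      \<le> (\<Sum>K\<in>d. norm (f (Sup K) - f (Inf K)) * B + A * norm (g (Sup K) - g (Inf K)))"
    proof (rule sum_mono)
      fix K assume "K \<in> d"
      from division_of_realE[OF d(1,2) this]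
      obtain u v where K: "u \<le> v" "{u..v} \<subseteq> {a..b}" "Inf K = u" "Sup K = v" by metis
      have "f v * g v - f u * g u = (f v - f u) * g v + f u * (g v - g u)" by (simp add: algebra_simps)
      also have "norm \<dots> \<le> norm (f v - f u) * norm (g v) + norm (f u) * norm (g v - g u)"
        by (intro norm_triangle_le add_mono norm_mult_ineq)
      also have "\<dots> \<le> norm (f v - f u) * B + A * norm (g v - g u)"
        using K A[of u] B[of v] by (intro add_mono mult_mono) (auto intro: order_trans[OF norm_ge_zero])
      finally show "norm (f (Sup K) * g (Sup K) - f (Inf K) * g (Inf K))
         \<le> norm (f (Sup K) - f (Inf K)) * B + A * norm (g (Sup K) - g (Inf K))" using K by simp
    qed
    also have "\<dots> = (\<Sum>K\<in>d. norm (f (Sup K) - f (Inf K))) * B + A * (\<Sum>K\<in>d. norm (g (Sup K) - g (Inf K)))"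
      by (simp add: sum.distrib sum_distrib_left sum_distrib_right)
    also have "\<dots> < e / (2 * B) * B + A * (e / (2 * A))"
      using \<delta>1[OF d(1,2)] \<delta>2[OF d(1,2)] d(3) \<open>A > 0\<close> \<open>B > 0\<close>
      by (intro add_strict_mono mult_strict_right_mono mult_strict_left_mono) auto
    also have "\<dots> = e" using \<open>A > 0\<close> \<open>B > 0\<close> by (simp add: field_simps)
    finally show ?thesis .
  qed
  moreover have "min \<delta>1 \<delta>2 > 0" using \<open>\<delta>1 > 0\<close> \<open>\<delta>2 > 0\<close> by simp
  ultimately show "\<exists>\<delta>>0. \<forall>d T. d division_of T \<and> T \<subseteq> {a..b} \<and> (\<Sum>K\<in>d. measure lborel K) < \<delta> \<longrightarrow>
        (\<Sum>K\<in>d. norm (f (Sup K) * g (Sup K) - f (Inf K) * g (Inf K))) < e" by blast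
qed

lemma abs_continuous_on_add:
  assumes f: "abs_continuous_on S f" and g: "abs_continuous_on S g"
  shows "abs_continuous_on S (\<lambda>x. f x + g x)"
  unfolding abs_continuous_on_def
proof (intro allI impI)
  fix e :: real assume "e > 0"
  have "e / 2 > 0" using \<open>e > 0\<close> by simp
  from abs_continuous_onD[OF f this]
  obtain \<delta>1 where "\<delta>1 > 0" and \<delta>1: "\<forall>d T. d division_of T \<longrightarrow> T \<subseteq> S \<longrightarrow>
      (\<Sum>K\<in>d. measure lborel K) < \<delta>1 \<longrightarrow> (\<Sum>K\<in>d. norm (f (Sup K) - f (Inf K))) < e / 2"
    by (elim exE conjE) (rule that)
  note \<delta>1 = \<delta>1[rule_format]
  have "e / 2 > 0" using \<open>e > 0\<close> by simp
  from abs_continuous_onD[OF g this]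
  obtain \<delta>2 where "\<delta>2 > 0" and \<delta>2: "\<forall>d T. d division_of T \<longrightarrow> T \<subseteq> S \<longrightarrow>
      (\<Sum>K\<in>d. measure lborel K) < \<delta>2 \<longrightarrow> (\<Sum>K\<in>d. norm (g (Sup K) - g (Inf K))) < e / 2"
    by (elim exE conjE) (rule that)
  note \<delta>2 = \<delta>2[rule_format]
  have "(\<Sum>K\<in>d. norm (f (Sup K) + g (Sup K) - (f (Inf K) + g (Inf K)))) < e"
    if d: "d division_of T" "T \<subseteq> S" "(\<Sum>K\<in>d. measure lborel K) < min \<delta>1 \<delta>2" for d T
  proof -
    have "(\<Sum>K\<in>d. norm (f (Sup K) + g (Sup K) - (f (Inf K) + g (Inf K))))
       \<le> (\<Sum>K\<in>d. norm (f (Sup K) - f (Inf K)) + norm (g (Sup K) - g (Inf K)))"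
      by (intro sum_mono norm_diff_triangle_ineq)
    also have "\<dots> < e"
      using \<delta>1[OF d(1,2)] \<delta>2[OF d(1,2)] d(3) by (simp add: sum.distrib)
    finally show ?thesis .
  qed
  moreover have "min \<delta>1 \<delta>2 > 0" using \<open>\<delta>1 > 0\<close> \<open>\<delta>2 > 0\<close> by simp
  ultimately show "\<exists>\<delta>>0. \<forall>d T. d division_of T \<and> T \<subseteq> S \<and> (\<Sum>K\<in>d. measure lborel K) < \<delta> \<longrightarrow>
        (\<Sum>K\<in>d. norm (f (Sup K) + g (Sup K) - (f (Inf K) + g (Inf K)))) < e" by blast
qed

text \<open>Split \<open>f\<close> into a polynomial \<open>g\<close> and a remainder small in L1.
  On every division the remainder contributes at most its L1 norm, and \<open>g\<close> at most its
  bound \<open>M\<close> times the total length.\<close>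

lemma abs_continuous_on_indefinite_integral:
  fixes f :: "real \<Rightarrow> 'a::euclidean_space"
  assumes f: "f absolutely_integrable_on {a..b}"
  shows "abs_continuous_on {a..b} (\<lambda>x. integral {a..x} f)"
  unfolding abs_continuous_on_def
proof (intro allI impI)
  fix e :: real assume "e > 0"
  obtain g where g: "polynomial_function g" and fg: "integral {a..b} (\<lambda>x. norm (f x - g x)) < e/2"
    using L1_polynomial_approx[OF f, of "e/2"] \<open>e > 0\<close> by auto
  have gc: "continuous_on S g" for S using g by (rule continuous_on_polymonial_function)
  obtain M where "M > 0" and M: "\<And>x. x \<in> {a..b} \<Longrightarrow> norm (g x) \<le> M"
    using compact_imp_bounded[OF compact_continuous_image[OF gc compact_Icc[of a b]]]
    unfolding bounded_pos by (metis image_eqI)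
  have fi: "f integrable_on {u..v}" and hi: "(\<lambda>x. norm (f x - g x)) integrable_on {u..v}"
    if "{u..v} \<subseteq> {a..b}" for u v
    using absolutely_integrable_on_subinterval[OF f that]
    by (auto intro!: absolutely_integrable_imp_norm_diff_integrable absolutely_integrable_continuous_real gc
         intro: set_lebesgue_integral_eq_integral(1))
  have "(\<Sum>K\<in>d. norm (integral {a..Sup K} f - integral {a..Inf K} f)) < e"
    if d: "d division_of T" "T \<subseteq> {a..b}" "(\<Sum>K\<in>d. measure lborel K) < e / (2 * M)" for d T
  proof -
    have hT: "(\<lambda>x. norm (f x - g x)) integrable_on T"
      using integrable_on_subdivision[OF d(1) hi[OF order_refl] d(2)] .
    have "(\<Sum>K\<in>d. norm (integral {a..Sup K} f - integral {a..Inf K} f))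
       \<le> (\<Sum>K\<in>d. integral K (\<lambda>x. norm (f x - g x)) + M * measure lborel K)"
    proof (rule sum_mono)
      fix K assume "K \<in> d"
      from division_of_realE[OF d(1,2) this]
      obtain u v where K: "K = {u..v}" "u \<le> v" "{u..v} \<subseteq> {a..b}" "Inf K = u" "Sup K = v"
          "measure lborel K = v - u" by metis
      have uv: "a \<le> u" "v \<le> b" using K by auto
      have "integral {a..v} f - integral {a..u} f = integral {u..v} f"
        using Henstock_Kurzweil_Integration.integral_combine[of a u v f] K(2) uv fi[of a v]
        by (auto simp: algebra_simps)
      also have "norm \<dots> \<le> integral {u..v} (\<lambda>x. norm (f x - g x) + M)"
      proof (rule Henstock_Kurzweil_Integration.integral_norm_bound_integral)
        show "norm (f x) \<le> norm (f x - g x) + M" if "x \<in> {u..v}" for x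
          using norm_triangle_ineq[of "f x - g x" "g x"] M[of x] that K(3) by auto
      qed (use fi[OF K(3)] hi[OF K(3)] in \<open>auto intro: integrable_add\<close>)
      also have "\<dots> = integral {u..v} (\<lambda>x. norm (f x - g x)) + M * (v - u)"
        using hi[OF K(3)] K(2)
        by (subst Henstock_Kurzweil_Integration.integral_add) (auto simp: mult.commute)
      finally show "norm (integral {a..Sup K} f - integral {a..Inf K} f)
        \<le> integral K (\<lambda>x. norm (f x - g x)) + M * measure lborel K" using K by simp
    qed
    also have "\<dots> = integral T (\<lambda>x. norm (f x - g x)) + M * (\<Sum>K\<in>d. measure lborel K)"
      using integral_combine_division_topdown[OF hT d(1)]
      by (simp add: sum.distrib sum_distrib_left)
    also have "integral T (\<lambda>x. norm (f x - g x)) \<le> integral {a..b} (\<lambda>x. norm (f x - g x))"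
      using d(2) hT hi[of a b] by (intro integral_subset_le) auto
    also have "integral {a..b} (\<lambda>x. norm (f x - g x)) + M * (\<Sum>K\<in>d. measure lborel K) < e/2 + M * (e / (2 * M))"
      using fg d(3) \<open>M > 0\<close> by (intro add_strict_mono mult_strict_left_mono) auto
    also have "\<dots> = e" using \<open>M > 0\<close> by simp
    finally show ?thesis by simp
  qed
  then show "\<exists>\<delta>>0. \<forall>d T. d division_of T \<and> T \<subseteq> {a..b} \<and> (\<Sum>K\<in>d. measure lborel K) < \<delta> \<longrightarrow>
        (\<Sum>K\<in>d. norm (integral {a..Sup K} f - integral {a..Inf K} f)) < e"
    using \<open>e > 0\<close> \<open>M > 0\<close> by (intro exI[of _ "e / (2 * M)"]) auto
qed

lemma abs_continuous_on_C1:
  fixes f :: "real \<Rightarrow> 'a::euclidean_space"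
  assumes f: "\<And>x. x \<in> {a..b} \<Longrightarrow> (f has_vector_derivative f' x) (at x within {a..b})"
    and f': "continuous_on {a..b} f'"
  shows "abs_continuous_on {a..b} f"
proof -
  have "f x = f a + integral {a..x} f'" if "x \<in> {a..b}" for x
  proof -
    have "(f' has_integral f x - f a) {a..x}"
      using that by (intro fundamental_theorem_of_calculus)
        (auto intro!: has_vector_derivative_within_subset[OF f])
    then show ?thesis by (simp add: integral_unique)
  qed
  moreover have "abs_continuous_on {a..b} (\<lambda>x. integral {a..x} f')"
    by (rule abs_continuous_on_indefinite_integral[OF absolutely_integrable_continuous_real[OF f']])
  then have "abs_continuous_on {a..b} (\<lambda>x. f a + integral {a..x} f')"
    by (rule abs_continuous_on_add[OF abs_continuous_on_const])
  ultimately show ?thesis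
    using abs_continuous_on_cong[of "{a..b}" f "\<lambda>x. f a + integral {a..x} f'"] by blast
qed

text \<open>The averages in \<open>integrable_ccontinuous_explicit\<close> run over cubes with
  \<open>x\<close> as lower corner. On the line these lie to the right of \<open>x\<close>, so only
  a one-sided derivative results.\<close>

lemma indefinite_integral_right_derivative:
  fixes f :: "real \<Rightarrow> 'a::euclidean_space"
  assumes "\<And>a b. f integrable_on {a..b}"
  shows "\<exists>N. negligible N \<and> (\<forall>x e. x \<notin> N \<longrightarrow> 0 < e \<longrightarrow>
     (\<exists>d>0. \<forall>h. 0 < h \<and> h < d \<longrightarrow> norm (integral {x..x + h} f /\<^sub>R h - f x) < e))"
proof (rule integrable_ccontinuous_explicit[of f])
  fix N
  assume N: "negligible N"
    and lim: "\<And>x e. \<lbrakk>x \<notin> N; 0 < e\<rbrakk> \<Longrightarrow> \<exists>d>0. \<forall>h. 0 < h \<and> h < d \<longrightarrow>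
       norm (integral (cbox x (x + h *\<^sub>R One)) f /\<^sub>R h ^ DIM(real) - f x) < e"
  show ?thesis
    by (intro exI[of _ N] conjI allI impI N) (use lim in simp)
qed (use assms in simp)

text \<open>A left derivative is a right derivative of the reflected function. The one-sided lemma
  is applied to both functions, and the second exceptional set is reflected back.\<close>

lemma indefinite_integral_has_vector_derivative_AE:
  fixes f :: "real \<Rightarrow> 'a::euclidean_space"
  assumes f: "f integrable_on {a..b}"
  shows "AE x in lebesgue. x \<in> {a<..<b} \<longrightarrow> ((\<lambda>x. integral {a..x} f) has_vector_derivative f x) (at x)"
proof -
  \<comment> \<open>Extension by 0 gives integrability on every interval, which the one-sided lemma
    asks for.\<close>
  define F where "F x = (if x \<in> {a..b} then f x else 0)" for x
  have Fi: "F integrable_on {u..v}" for u v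
  proof -
    have "F integrable_on UNIV" using f integrable_restrict_UNIV[of "{a..b}" f] unfolding F_def by blast
    then show ?thesis using integrable_on_subcbox[of F UNIV u v] by simp
  qed
  obtain N where N: "negligible N"
    and right: "\<forall>x e. x \<notin> N \<longrightarrow> 0 < e \<longrightarrow> (\<exists>d>0. \<forall>h. 0 < h \<and> h < d \<longrightarrow>
       norm (integral {x..x + h} F /\<^sub>R h - F x) < e)"
    using indefinite_integral_right_derivative[of F, OF Fi] by (elim exE conjE) (rule that)
  have Fi': "(\<lambda>x. F (- x)) integrable_on {u..v}" for u v
    using Fi[of "- v" "- u"] Henstock_Kurzweil_Integration.integrable_reflect_real[where f = F and a = "- v" and b = "- u"]
    by simp
  obtain N' where N': "negligible N'"
    and left: "\<forall>x e. x \<notin> N' \<longrightarrow> 0 < e \<longrightarrow> (\<exists>d>0. \<forall>h. 0 < h \<and> h < d \<longrightarrow>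
       norm (integral {x..x + h} (\<lambda>x. F (- x)) /\<^sub>R h - F (- x)) < e)"
    using indefinite_integral_right_derivative[of "\<lambda>x. F (- x)", OF Fi'] by (elim exE conjE) (rule that)
  have "negligible (N \<union> uminus ` N')"
    using N negligible_differentiable_image_negligible[of N' uminus, OF _ N']
    by (auto intro: derivative_intros)
  moreover have "((\<lambda>x. integral {a..x} f) has_vector_derivative f x) (at x)"
    if x: "x \<in> {a<..<b}" "x \<notin> N \<union> uminus ` N'" for x
  proof -
    have "- x \<notin> N'" using x(2) by (auto simp: image_iff)
    have eq: "integral {u..v} F = integral {a..v} f - integral {a..u} f"
      if "a \<le> u" "u \<le> v" "v \<le> b" for u v
    proof -
      have "integral {u..v} F = integral {u..v} f"
        using that by (intro Henstock_Kurzweil_Integration.integral_cong) (auto simp: F_def)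
      moreover have "f integrable_on {a..v}"
        using integrable_subinterval_real[OF f, of a v] that by auto
      ultimately show ?thesis
        using Henstock_Kurzweil_Integration.integral_combine[of a u v f] that by (auto simp: algebra_simps)
    qed
    have fx: "F x = f x" using x by (auto simp: F_def)
    show ?thesis
      unfolding has_vector_derivative_def has_derivative_at_alt
    proof (intro conjI allI impI bounded_linear_scaleR_left)
      fix e :: real assume "e > 0"
      obtain d1 where d1: "d1 > 0" "\<And>h. 0 < h \<Longrightarrow> h < d1 \<Longrightarrow> norm (integral {x..x + h} F /\<^sub>R h - f x) < e"
        using right[rule_format, of x e] x \<open>e > 0\<close> fx by auto
      obtain d2 where d2: "d2 > 0" "\<And>h. 0 < h \<Longrightarrow> h < d2 \<Longrightarrow>
           norm (integral {- x..- x + h} (\<lambda>x. F (- x)) /\<^sub>R h - f x) < e"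
        using left[rule_format, of "- x" e] \<open>- x \<notin> N'\<close> \<open>e > 0\<close> fx by auto
      \<comment> \<open>The last two entries keep \<open>y\<close> in \<open>{a..b}\<close>, where
        \<open>F\<close> agrees with \<open>f\<close>.\<close>
      define d where "d = Min {d1, d2, x - a, b - x}"
      have d: "d > 0" "d \<le> d1" "d \<le> d2" "d \<le> x - a" "d \<le> b - x"
        using d1(1) d2(1) x(1) by (auto simp: d_def)
      have scale: "norm (z - h *\<^sub>R f x) \<le> e * h" if "norm (z /\<^sub>R h - f x) < e" "h > 0" for z h
      proof -
        have "z - h *\<^sub>R f x = h *\<^sub>R (z /\<^sub>R h - f x)" using \<open>h > 0\<close> by (simp add: algebra_simps)
        then show ?thesis using that by simp
      qed
      have "norm (integral {a..y} f - integral {a..x} f - (y - x) *\<^sub>R f x) \<le> e * norm (y - x)"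
        if "norm (y - x) < d" for y
      proof (cases y x rule: linorder_cases)
        case greater
        have "integral {a..y} f - integral {a..x} f = integral {x..x + (y - x)} F"
          using eq[of x y] greater that d x by auto
        then show ?thesis using scale[OF d1(2)[of "y - x"]] greater that d by simp
      next
        case less
        have "integral {a..x} f - integral {a..y} f = integral {y..x} F"
          using eq[of y x] less that d x by auto
        also have "\<dots> = integral {- x..- x + (x - y)} (\<lambda>x. F (- x))"
          using Henstock_Kurzweil_Integration.integral_reflect_real[of x y F] by simp
        finally have "norm (integral {a..x} f - integral {a..y} f - (x - y) *\<^sub>R f x) \<le> e * (x - y)"
          using scale[OF d2(2)[of "x - y"]] less that d by simp
        moreover have "integral {a..y} f - integral {a..x} f - (y - x) *\<^sub>R f x
           = - (integral {a..x} f - integral {a..y} f - (x - y) *\<^sub>R f x)"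
          by (simp add: algebra_simps)
        ultimately show ?thesis using less by (simp only: norm_minus_cancel) simp
      qed auto
      with d(1) show "\<exists>d>0. \<forall>y. norm (y - x) < d \<longrightarrow>
          norm (integral {a..y} f - integral {a..x} f - (y - x) *\<^sub>R f x) \<le> e * norm (y - x)" by blast
    qed
  qed
  ultimately show ?thesis
    by (intro AE_I'[of "N \<union> uminus ` N'"]) (auto simp: negligible_iff_null_sets)
qed

text \<open>
  Tags outside the null set where the derivative fails contribute little by differentiability; the
  intervals with the other tags lie in an open set of small measure, so absolute continuity applies.
\<close>

lemma abs_continuous_on_deriv_zero_imp_constant:
  fixes f :: "real \<Rightarrow> 'a::real_normed_vector"
  assumes ac: "abs_continuous_on {a..b} f"
    and deriv: "AE x in lebesgue. a < x \<and> x < b \<longrightarrow> (f has_vector_derivative 0) (at x)"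
    and "a \<le> b"
  shows "f b = f a"
proof -
  \<comment> \<open>The endpoints count as exceptional, so every remaining tag is an interior point
    with derivative 0.\<close>
  define N where "N = {x \<in> {a..b}. \<not> (a < x \<and> x < b \<and> (f has_vector_derivative 0) (at x))}"
  have "negligible {x. \<not> (a < x \<and> x < b \<longrightarrow> (f has_vector_derivative 0) (at x))}"
    using deriv by (auto simp: negligible_iff_null_sets eventually_ae_filter intro: null_sets_completion_subset)
  then have N: "negligible N"
    by (rule_tac negligible_subset[OF negligible_insert[THEN iffD2, OF negligible_insert[THEN iffD2]], of _ _ a b])
       (auto simp: N_def)
  have "norm (f b - f a) \<le> e" if "e > 0" for e
  proof -
    have "e / 2 > 0" using \<open>e > 0\<close> by simp
  from abs_continuous_onD[OF ac this]
  obtain \<delta> where "\<delta> > 0" and \<delta>: "\<forall>d T. d division_of T \<longrightarrow> T \<subseteq> {a..b} \<longrightarrow>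
      (\<Sum>K\<in>d. measure lborel K) < \<delta> \<longrightarrow> (\<Sum>K\<in>d. norm (f (Sup K) - f (Inf K))) < e / 2"
    by (elim exE conjE) (rule that)
  note \<delta> = \<delta>[rule_format]
    define \<eta> where "\<eta> = e / (2 * (b - a + 1))"
    have "\<eta> > 0" using \<open>e > 0\<close> \<open>a \<le> b\<close> by (simp add: \<eta>_def)
    obtain U where U: "N \<subseteq> U" "open U" "U \<in> lmeasurable" "measure lebesgue U < \<delta>"
    proof -
      \<comment> \<open>Outer regularity bounds only \<open>U - N\<close>; adding the null set
        \<open>N\<close> does not change the measure.\<close>
      obtain U where "open U" "N \<subseteq> U" "U - N \<in> lmeasurable" "emeasure lebesgue (U - N) < ennreal \<delta>"
        using sets_lebesgue_outer_open[OF negligible_imp_sets[OF N] \<open>\<delta> > 0\<close>] by blast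
      moreover have "N \<in> lmeasurable" using N by (rule negligible_imp_measurable)
      moreover have "U = (U - N) \<union> N" using \<open>N \<subseteq> U\<close> by auto
      moreover have "measure lebesgue ((U - N) \<union> N) = measure lebesgue (U - N)"
        by (rule measure_negligible_symdiff) (use N \<open>U - N \<in> lmeasurable\<close> in \<open>auto intro: negligible_subset\<close>)
      ultimately show ?thesis
        using that \<open>\<delta> > 0\<close>
        by (metis emeasure_eq_measure2 ennreal_less_iff fmeasurable.Un measure_nonneg)
    qed
    have "\<exists>r>0. (x \<in> N \<longrightarrow> ball x r \<subseteq> U) \<and>
       (x \<in> {a..b} - N \<longrightarrow> (\<forall>y. \<bar>y - x\<bar> < r \<longrightarrow> norm (f y - f x) \<le> \<eta> * \<bar>y - x\<bar>))" for x
    proof (cases "x \<in> N")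
      case True
      then show ?thesis using U openE by blast
    next
      case False
      show ?thesis
      proof (cases "x \<in> {a..b}")
        case True
        then have "(f has_vector_derivative 0) (at x)" using False by (auto simp: N_def)
        then have "\<exists>d>0. \<forall>y. norm (y - x) < d \<longrightarrow> norm (f y - f x - (y - x) *\<^sub>R 0) \<le> \<eta> * norm (y - x)"
          using \<open>\<eta> > 0\<close> unfolding has_vector_derivative_def has_derivative_at_alt by blast
        then show ?thesis using False by auto
      qed (use False in \<open>auto intro: exI[of _ 1]\<close>)
    qed
    then obtain r where r: "\<And>x. r x > 0" "\<And>x. x \<in> N \<Longrightarrow> ball x (r x) \<subseteq> U"
      "\<And>x y. x \<in> {a..b} - N \<Longrightarrow> \<bar>y - x\<bar> < r x \<Longrightarrow> norm (f y - f x) \<le> \<eta> * \<bar>y - x\<bar>"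
      by metis
    obtain p where p: "p tagged_division_of {a..b}" "(\<lambda>x. ball x (r x)) fine p"
      using fine_division_exists_real[OF gauge_ball_dependent] r(1) by blast
    have fp: "finite p" using p(1) by blast
    have K: "\<exists>u v. K = {u..v} \<and> u \<le> x \<and> x \<le> v \<and> a \<le> u \<and> v \<le> b \<and> {u..v} \<subseteq> ball x (r x)"
      if "(x, K) \<in> p" for x K
    proof -
      from tagged_division_ofD(4)[OF p(1) that] obtain u v where "K = cbox u v" by blast
      moreover have "x \<in> K" "K \<subseteq> {a..b}" using tagged_division_ofD(2,3)[OF p(1) that] by auto
      moreover have "K \<subseteq> ball x (r x)" using p(2) that by (auto simp: fine_def)
      ultimately show ?thesis by (intro exI[of _ u] exI[of _ v]) auto
    qed
    define p1 where "p1 = {t \<in> p. fst t \<in> N}"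
    define p2 where "p2 = {t \<in> p. fst t \<notin> N}"
    have p12: "p = p1 \<union> p2" "p1 \<inter> p2 = {}" "finite p1" "finite p2" using fp by (auto simp: p1_def p2_def)
    have "f b - f a = (\<Sum>(x, K)\<in>p. f (Sup K) - f (Inf K))"
      using additive_tagged_division_1[OF \<open>a \<le> b\<close> p(1), of f] by simp
    also have "norm \<dots> \<le> (\<Sum>(x, K)\<in>p. norm (f (Sup K) - f (Inf K)))"
      by (rule order_trans[OF norm_sum]) (simp add: split_def)
    also have "\<dots> = (\<Sum>(x, K)\<in>p1. norm (f (Sup K) - f (Inf K))) + (\<Sum>(x, K)\<in>p2. norm (f (Sup K) - f (Inf K)))"
      using p12 by (simp add: sum.union_disjoint)
    also have "(\<Sum>(x, K)\<in>p2. norm (f (Sup K) - f (Inf K))) \<le> (\<Sum>(x, K)\<in>p2. \<eta> * (Sup K - Inf K))"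
    proof (rule sum_mono, clarify)
      fix x K assume xK: "(x, K) \<in> p2"
      then have "(x, K) \<in> p" "x \<notin> N" by (auto simp: p2_def)
      from K[OF this(1)] obtain u v where uv: "K = {u..v}" "u \<le> x" "x \<le> v" "a \<le> u" "v \<le> b" "{u..v} \<subseteq> ball x (r x)"
        by blast
      have "u \<in> {u..v}" "v \<in> {u..v}" using uv by auto
      with uv(6) have "u \<in> ball x (r x)" "v \<in> ball x (r x)" by blast+
      then have "norm (f u - f x) \<le> \<eta> * \<bar>u - x\<bar>" "norm (f v - f x) \<le> \<eta> * \<bar>v - x\<bar>"
        using r(3)[of x u] r(3)[of x v] uv \<open>x \<notin> N\<close> by (auto simp: dist_real_def)
      moreover have "norm (f v - f u) \<le> norm (f v - f x) + norm (f u - f x)"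
        using norm_triangle_ineq4[of "f v - f x" "f u - f x"] by simp
      ultimately have "norm (f v - f u) \<le> \<eta> * (v - u)" using uv by (simp add: algebra_simps)
      then show "norm (f (Sup K) - f (Inf K)) \<le> \<eta> * (Sup K - Inf K)" using uv by simp
    qed
    also have "\<dots> \<le> (\<Sum>(x, K)\<in>p. \<eta> * (Sup K - Inf K))"
    proof (rule sum_mono2)
      fix t assume "t \<in> p - p2"
      then show "0 \<le> (case t of (x, K) \<Rightarrow> \<eta> * (Sup K - Inf K))"
        using K[of "fst t" "snd t"] \<open>\<eta> > 0\<close> by (auto simp: split_def)
    qed (use p12 in auto)
    also have "\<dots> = \<eta> * (b - a)"
      using additive_tagged_division_1[OF \<open>a \<le> b\<close> p(1), of "\<lambda>x. x"]
      by (simp add: split_def flip: sum_distrib_left)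
    also have "\<dots> \<le> e / 2"
      using \<open>a \<le> b\<close> \<open>e > 0\<close> by (simp add: \<eta>_def field_simps)
    also have "(\<Sum>(x, K)\<in>p1. norm (f (Sup K) - f (Inf K))) \<le> e / 2"
    proof -
      \<comment> \<open>Two different tags of one interval would both lie in it and force a nonempty
        interior, against the disjointness of interiors. So the tagged sum is a sum over a division,
        as absolute continuity requires.\<close>
      have inj: "inj_on snd p1"
      proof (rule inj_onI)
        fix s t assume st: "s \<in> p1" "t \<in> p1" "snd s = snd t"
        obtain x K where s: "s = (x, K)" by (cases s)
        with st(3) obtain y where t: "t = (y, K)" by (cases t) auto
        from st s t have "(x, K) \<in> p" "(y, K) \<in> p" by (auto simp: p1_def)
        with K[OF this(1)] K[OF this(2)] obtain u v where uv: "K = {u..v}" "x \<in> {u..v}" "y \<in> {u..v}"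
          by fastforce
        show "s = t"
        proof (rule ccontr)
          assume "s \<noteq> t"
          then have "x \<noteq> y" using s t by simp
          then have "interior K \<inter> interior K = {}"
            using tagged_division_ofD(5)[OF p(1) \<open>(x, K) \<in> p\<close> \<open>(y, K) \<in> p\<close>] by auto
          then show False using uv \<open>x \<noteq> y\<close> by auto
        qed
      qed
      have "p1 tagged_partial_division_of {a..b}"
        using p(1) tagged_partial_division_subset[of p "{a..b}" p1]
        by (auto simp: tagged_division_of_def p1_def)
      then have "p1 tagged_division_of \<Union>(snd ` p1)" by (rule tagged_partial_division_of_Union_self)
      then have d: "snd ` p1 division_of \<Union>(snd ` p1)" by (rule division_of_tagged_division)
      have "\<Union>(snd ` p1) \<subseteq> {a..b} \<inter> U"
      proof clarify
        fix z x K assume "(x, K) \<in> p1" "z \<in> snd (x, K)"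
        then have "(x, K) \<in> p" "x \<in> N" "z \<in> K" by (auto simp: p1_def)
        with K[OF this(1)] r(2)[OF this(2)] show "z \<in> {a..b} \<inter> U" by fastforce
      qed
      moreover have "(\<Sum>K\<in>snd ` p1. measure lborel K) = measure lebesgue (\<Union>(snd ` p1))"
      proof -
        have "measure lborel K = measure lebesgue K" if "K \<in> snd ` p1" for K
          using division_ofD(4)[OF d that] by (auto intro: measure_completion[symmetric])
        then show ?thesis using content_division[OF d] by simp
      qed
      moreover have "measure lebesgue (\<Union>(snd ` p1)) \<le> measure lebesgue U"
        using calculation(1) U(3) lmeasurable_division[OF d] by (intro measure_mono_fmeasurable) auto
      ultimately have "(\<Sum>K\<in>snd ` p1. norm (f (Sup K) - f (Inf K))) < e / 2"
        using U(4) by (intro \<delta>[OF d]) auto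
      then show ?thesis using inj by (simp add: sum.reindex split_def)
    qed
    finally show ?thesis by simp
  qed
  then have "norm (f b - f a) \<le> 0" by (rule field_le_epsilon[of _ 0]) auto
  then show ?thesis by simp
qed

section \<open>Integrals depending on a complex parameter\<close>

lemma absolutely_integrable_mult_continuous:
  fixes f g :: "real \<Rightarrow> complex"
  assumes "f absolutely_integrable_on {a..b}" "continuous_on {a..b} g"
  shows "(\<lambda>t. f t * g t) absolutely_integrable_on {a..b}"
proof -
  have bil: "bilinear ((*) :: complex \<Rightarrow> complex \<Rightarrow> complex)"
    by (simp add: bilinear_conv_bounded_bilinear bounded_bilinear_mult)
  have meas: "g \<in> borel_measurable (lebesgue_on {a..b})"
    by (rule absolutely_integrable_imp_borel_measurable[OF absolutely_integrable_continuous_real[OF assms(2)]]) simp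
  have bdd: "bounded (g ` {a..b})"
    by (rule compact_imp_bounded[OF compact_continuous_image[OF assms(2) compact_Icc]])
  have "{a..b} \<in> sets lebesgue" by simp
  from absolutely_integrable_bounded_measurable_product[OF bil meas this bdd assms(1)]
  show ?thesis by (simp only: mult.commute)
qed

lemma norm_integral_mult_le:
  fixes f g :: "real \<Rightarrow> complex"
  assumes f: "f absolutely_integrable_on {a..b}" and g: "continuous_on {a..b} g"
    and B: "\<And>t. t \<in> {a..b} \<Longrightarrow> norm (g t) \<le> B"
  shows "norm (integral {a..b} (\<lambda>t. f t * g t)) \<le> integral {a..b} (\<lambda>t. norm (f t)) * B"
proof -
  have "norm (integral {a..b} (\<lambda>t. f t * g t)) \<le> integral {a..b} (\<lambda>t. norm (f t) * B)"
    using absolutely_integrable_mult_continuous[OF f g] f B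
    by (intro Henstock_Kurzweil_Integration.integral_norm_bound_integral)
       (auto simp: absolutely_integrable_on_def norm_mult intro!: mult_left_mono integrable_on_mult_left)
  then show ?thesis by simp
qed

text \<open>Differentiation under the integral sign. Cauchy's inequality turns the locally uniform
  bound on \<open>h t\<close> into a bound on its derivative, hence on its difference quotients, and
  dominated convergence applies along every sequence tending to \<open>z0\<close>.\<close>

lemma holomorphic_on_integral_mult:
  fixes f :: "real \<Rightarrow> complex" and h :: "real \<Rightarrow> complex \<Rightarrow> complex"
  assumes f: "f absolutely_integrable_on {a..b}"
    and hol: "\<And>t. t \<in> {a..b} \<Longrightarrow> h t holomorphic_on UNIV"
    and cont: "\<And>z. continuous_on {a..b} (\<lambda>t. h t z)"
    and bdd: "\<And>r. \<exists>K. \<forall>t\<in>{a..b}. \<forall>z\<in>cball 0 r. norm (h t z) \<le> K"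
  shows "(\<lambda>z. integral {a..b} (\<lambda>t. f t * h t z)) holomorphic_on UNIV"
  unfolding holomorphic_on_def
proof
  fix z0 :: complex
  \<comment> \<open>The radius \<open>norm z0 + 2\<close> leaves room for unit circles around the
    points of \<open>ball z0 1\<close>.\<close>
  obtain K where "\<forall>t\<in>{a..b}. \<forall>z\<in>cball 0 (norm z0 + 2). norm (h t z) \<le> K"
    using bdd[of "norm z0 + 2"] by blast
  then have K: "norm (h t z) \<le> K" if "t \<in> {a..b}" "norm z \<le> norm z0 + 2" for t z
    using that by simp
  have int: "(\<lambda>t. f t * h t z) integrable_on {a..b}" for z
    using absolutely_integrable_mult_continuous[OF f cont] by (rule set_lebesgue_integral_eq_integral(1))
  have deriv: "(h t has_field_derivative deriv (h t) w) (at w)" if "t \<in> {a..b}" for t w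
    using hol[OF that] by (simp add: holomorphic_derivI)
  have deriv_bound: "norm (deriv (h t) w) \<le> K" if t: "t \<in> {a..b}" and w: "w \<in> ball z0 1" for t w
  proof -
    have "norm ((deriv ^^ 1) (h t) w) \<le> fact 1 * K / 1 ^ 1"
    proof (rule Cauchy_inequality)
      show "h t holomorphic_on ball w 1" "continuous_on (cball w 1) (h t)"
        using hol[OF t] by (auto intro: holomorphic_on_subset holomorphic_on_imp_continuous_on continuous_on_subset)
      show "norm (h t x) \<le> K" if "norm (w - x) = 1" for x
      proof (rule K[OF t])
        have "norm x \<le> norm w + norm (w - x)" using norm_triangle_ineq4[of w "w - x"] by simp
        moreover have "norm w \<le> norm z0 + norm (w - z0)" using norm_triangle_ineq[of z0 "w - z0"] by simp
        ultimately show "norm x \<le> norm z0 + 2" using that w by (simp add: dist_norm norm_minus_commute)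
      qed
    qed auto
    then show ?thesis by simp
  qed
  have lip: "norm ((h t z - h t z0) / (z - z0)) \<le> K" if t: "t \<in> {a..b}" and z: "z \<in> ball z0 1" "z \<noteq> z0" for t z
  proof -
    have "norm (h t z - h t z0) \<le> K * norm (z - z0)"
      by (rule field_differentiable_bound[OF convex_ball[of z0 1] _ deriv_bound])
         (use deriv[OF t] t z in \<open>auto intro: has_field_derivative_at_within\<close>)
    then show ?thesis using z(2) by (simp add: norm_divide field_simps)
  qed
  define D where "D = integral {a..b} (\<lambda>t. f t * deriv (h t) z0)"
  have "((\<lambda>z. (integral {a..b} (\<lambda>t. f t * h t z) - integral {a..b} (\<lambda>t. f t * h t z0)) / (z - z0)) \<longlongrightarrow> D) (at z0)"
    unfolding tendsto_at_iff_sequentially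
  proof (intro allI impI)
    fix X :: "nat \<Rightarrow> complex" assume X: "\<forall>i. X i \<in> UNIV - {z0}" "X \<longlonglongrightarrow> z0"
    have "\<forall>\<^sub>F i in sequentially. dist (X i) z0 < 1"
      using X(2) by (intro tendstoD) auto
    then obtain n0 where "\<And>i. i \<ge> n0 \<Longrightarrow> dist (X i) z0 < 1" unfolding eventually_sequentially by blast
    \<comment> \<open>Dropping the first \<open>n0\<close> terms puts the sequence into the ball on
      which the quotients are bounded.\<close>
    then have Y: "X (i + n0) \<in> ball z0 1" "X (i + n0) \<noteq> z0" for i using X(1) by (auto simp: dist_commute)
    have eq: "(integral {a..b} (\<lambda>t. f t * h t z) - integral {a..b} (\<lambda>t. f t * h t z0)) / (z - z0)
       = integral {a..b} (\<lambda>t. f t * ((h t z - h t z0) / (z - z0)))" for z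
      by (simp add: Henstock_Kurzweil_Integration.integral_diff[OF int int, symmetric] right_diff_distrib
          flip: integral_divide)
    have "(\<lambda>i. integral {a..b} (\<lambda>t. f t * ((h t (X (i + n0)) - h t z0) / (X (i + n0) - z0)))) \<longlonglongrightarrow> D"
      unfolding D_def
    proof (rule dominated_convergence(2))
      show "(\<lambda>t. f t * ((h t (X (i + n0)) - h t z0) / (X (i + n0) - z0))) integrable_on {a..b}" for i
        by (intro set_lebesgue_integral_eq_integral(1) absolutely_integrable_mult_continuous[OF f]
            continuous_on_divide continuous_on_diff continuous_on_const cont) (use Y(2) in auto)
      show "(\<lambda>t. norm (f t) * K) integrable_on {a..b}"
        using f by (auto simp: absolutely_integrable_on_def intro: integrable_on_mult_left)
      show "norm (f t * ((h t (X (i + n0)) - h t z0) / (X (i + n0) - z0))) \<le> norm (f t) * K"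
        if "t \<in> {a..b}" for i t
        unfolding norm_mult using lip[OF that Y] by (intro mult_left_mono) auto
      show "(\<lambda>i. f t * ((h t (X (i + n0)) - h t z0) / (X (i + n0) - z0))) \<longlonglongrightarrow> f t * deriv (h t) z0"
        if "t \<in> {a..b}" for t
      proof (rule tendsto_mult_left)
        have "((\<lambda>z. (h t z - h t z0) / (z - z0)) \<longlongrightarrow> deriv (h t) z0) (at z0)"
          using deriv[OF that] by (simp add: has_field_derivative_iff)
        moreover have "(\<lambda>i. X (i + n0)) \<longlonglongrightarrow> z0" using X(2) by (rule LIMSEQ_ignore_initial_segment)
        ultimately show "(\<lambda>i. (h t (X (i + n0)) - h t z0) / (X (i + n0) - z0)) \<longlonglongrightarrow> deriv (h t) z0"
          using Y(2) unfolding tendsto_at_iff_sequentially comp_def by simp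
      qed
    qed
    then have "(\<lambda>i. (integral {a..b} (\<lambda>t. f t * h t (X (i + n0))) - integral {a..b} (\<lambda>t. f t * h t z0)) / (X (i + n0) - z0)) \<longlonglongrightarrow> D"
      unfolding eq .
    then show "((\<lambda>z. (integral {a..b} (\<lambda>t. f t * h t z) - integral {a..b} (\<lambda>t. f t * h t z0)) / (z - z0)) \<circ> X) \<longlonglongrightarrow> D"
      unfolding comp_def by (rule LIMSEQ_offset)
  qed
  then show "(\<lambda>z. integral {a..b} (\<lambda>t. f t * h t z)) field_differentiable at z0 within UNIV"
    unfolding field_differentiable_def has_field_derivative_iff by (intro exI[of _ D]) simp
qed

lemma norm_exp_i_mult_le:
  assumes "\<bar>s\<bar> \<le> r"
  shows "norm (exp (\<i> * l * complex_of_real s)) \<le> exp (\<bar>Im l\<bar> * r)"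
proof -
  have "- (Im l * s) \<le> \<bar>Im l\<bar> * \<bar>s\<bar>" by (metis abs_ge_minus_self abs_mult)
  also have "\<dots> \<le> \<bar>Im l\<bar> * r" using assms by (intro mult_left_mono) auto
  finally show ?thesis by (simp add: algebra_simps)
qed

text \<open>Since \<open>f\<close> vanishes below \<open>a\<close>, only t in [a, x] matters, and
  there |x + a - 2t| <= (x - t) + (t - a) <= x, so the exponential is at most exp(|Im l| x).
  Replacing \<open>f\<close> by a polynomial costs a small multiple of this bound, and for the
  polynomial integration by parts gains a factor 1/|l|. Both bounds are uniform in x.\<close>

lemma riemann_lebesgue_exp:
  fixes f :: "real \<Rightarrow> complex"
  assumes f: "f absolutely_integrable_on {0..b}" and a: "a \<ge> 0" and f0: "\<And>t. t < a \<Longrightarrow> f t = 0" and "e > 0"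
  shows "\<forall>\<^sub>F l in at_infinity. \<forall>x\<in>{0..b}.
     norm (integral {0..x} (\<lambda>t. f t * exp (\<i> * l * complex_of_real (x + a - 2 * t)))) \<le> e * exp (\<bar>Im l\<bar> * x)"
proof -
  obtain g where g: "polynomial_function g" and fg: "integral {0..b} (\<lambda>x. norm (f x - g x)) < e/2"
    using L1_polynomial_approx[OF f, of "e/2"] \<open>e > 0\<close> by auto
  obtain g' where g': "polynomial_function g'" and gd: "\<And>x. (g has_vector_derivative g' x) (at x)"
    using has_vector_derivative_polynomial_function[OF g] by blast
  note gc = continuous_on_polymonial_function[OF g] and gc' = continuous_on_polymonial_function[OF g']
  have "bounded (g ` {0..b})" "bounded (g' ` {0..b})"
    by (intro compact_imp_bounded compact_continuous_image gc gc' compact_Icc)+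
  then obtain M M' where "M > 0" "M' > 0" and M: "\<And>x. x \<in> {0..b} \<Longrightarrow> norm (g x) \<le> M"
    and M': "\<And>x. x \<in> {0..b} \<Longrightarrow> norm (g' x) \<le> M'"
    unfolding bounded_pos by (metis image_eqI)
  \<comment> \<open>Chosen so that the boundary terms and the remaining integral after integration
    by parts stay below e/2 times the exponential; the summand 1 excludes l = 0.\<close>
  define R where "R = (2 * M + \<bar>b\<bar> * M') / e + 1"
  have "norm (integral {0..x} (\<lambda>t. f t * exp (\<i> * l * complex_of_real (x + a - 2 * t)))) \<le> e * exp (\<bar>Im l\<bar> * x)"
    if l: "norm l \<ge> R" and x: "x \<in> {0..b}" for l x
  proof (cases "x < a")
    case True
    have "integral {0..x} (\<lambda>t. f t * exp (\<i> * l * complex_of_real (x + a - 2 * t))) = integral {0..x} (\<lambda>t. 0)"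
      using True by (intro Henstock_Kurzweil_Integration.integral_cong) (auto simp: f0)
    then show ?thesis using \<open>e > 0\<close> by simp
  next
    case False
    define E where "E t = exp (\<i> * l * complex_of_real (x + a - 2 * t))" for t
    define B where "B = exp (\<bar>Im l\<bar> * x)"
    have "B > 0" by (simp add: B_def)
    have R: "R \<ge> 1" using \<open>M > 0\<close> \<open>M' > 0\<close> \<open>e > 0\<close> by (simp add: R_def)
    have l0: "l \<noteq> 0" "norm l > 0" using l R by auto
    have EB: "norm (E t) \<le> B" if "t \<in> {a..x}" for t
      unfolding E_def B_def using that False a by (intro norm_exp_i_mult_le) auto
    have Ec: "continuous_on S E" for S unfolding E_def by (intro continuous_intros)
    have sub: "{a..x} \<subseteq> {0..b}" using x a by auto
    have fgi: "(\<lambda>t. f t - g t) absolutely_integrable_on {0..b}"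
      by (intro set_integral_diff f absolutely_integrable_continuous_real gc)
    have fgi': "(\<lambda>t. f t - g t) absolutely_integrable_on {a..x}"
      by (rule absolutely_integrable_on_subinterval[OF fgi sub])
    have fi: "f absolutely_integrable_on {a..x}"
      by (rule absolutely_integrable_on_subinterval[OF f sub])
    have fEi: "(\<lambda>t. f t * E t) integrable_on {0..x}"
      using absolutely_integrable_mult_continuous[OF absolutely_integrable_on_subinterval[OF f, of 0 x] Ec] x
      by (auto intro: set_lebesgue_integral_eq_integral(1))
    have gEi: "(\<lambda>t. g t * E t) integrable_on {a..x}"
      by (intro integrable_continuous_real continuous_on_mult gc Ec)
    have "integral {0..x} (\<lambda>t. f t * E t) = integral {0..a} (\<lambda>t. f t * E t) + integral {a..x} (\<lambda>t. f t * E t)"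
      using Henstock_Kurzweil_Integration.integral_combine[of 0 a x, OF _ _ fEi] a False by simp
    \<comment> \<open>At t = a itself \<open>f\<close> may be nonzero, so this point is discarded as
      a null set.\<close>
    also have "integral {0..a} (\<lambda>t. f t * E t) = integral {0..a} (\<lambda>t. 0)"
      by (rule integral_spike[of "{a}"]) (auto simp: f0)
    also have "integral {a..x} (\<lambda>t. f t * E t)
        = integral {a..x} (\<lambda>t. (f t - g t) * E t + g t * E t)"
      by (simp add: algebra_simps)
    also have "\<dots> = integral {a..x} (\<lambda>t. (f t - g t) * E t) + integral {a..x} (\<lambda>t. g t * E t)"
      using absolutely_integrable_mult_continuous[OF fgi' Ec] gEi
      by (intro Henstock_Kurzweil_Integration.integral_add) (auto intro: set_lebesgue_integral_eq_integral(1))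
    finally have split: "integral {0..x} (\<lambda>t. f t * E t)
       = integral {a..x} (\<lambda>t. (f t - g t) * E t) + integral {a..x} (\<lambda>t. g t * E t)" by simp
    have "norm (integral {a..x} (\<lambda>t. (f t - g t) * E t)) \<le> integral {a..x} (\<lambda>t. norm (f t - g t)) * B"
      by (rule norm_integral_mult_le[OF fgi' Ec EB])
    also have "\<dots> \<le> e / 2 * B"
    proof (rule mult_right_mono)
      have "integral {a..x} (\<lambda>t. norm (f t - g t)) \<le> integral {0..b} (\<lambda>t. norm (f t - g t))"
        using sub fgi fgi' by (intro integral_subset_le) (auto simp: absolutely_integrable_on_def)
      then show "integral {a..x} (\<lambda>t. norm (f t - g t)) \<le> e / 2" using fg by linarith
    qed (use \<open>B > 0\<close> in simp)
    finally have 1: "norm (integral {a..x} (\<lambda>t. (f t - g t) * E t)) \<le> e / 2 * B" .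
    \<comment> \<open>\<open>E t / (- 2 * \<i> * l)\<close> is an antiderivative of
      \<open>E\<close>, so \<open>G\<close> is the boundary term of the integration by
      parts.\<close>
    define G where "G t = g t * E t / (- 2 * \<i> * l)" for t
    have "((\<lambda>t. g' t * E t / (- 2 * \<i> * l) + g t * E t) has_integral G x - G a) {a..x}"
    proof (rule fundamental_theorem_of_calculus)
      fix t assume "t \<in> {a..x}"
      have "(E has_vector_derivative E t * (- 2 * \<i> * l)) (at t)"
      proof -
        have "((\<lambda>z. exp (\<i> * l * (of_real (x + a) - 2 * z))) has_field_derivative E t * (- 2 * \<i> * l)) (at (of_real t))"
          unfolding E_def by (auto intro!: derivative_eq_intros simp: algebra_simps)
        from has_vector_derivative_real_field[OF this] show ?thesis unfolding E_def by simp
      qed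
      then have "((\<lambda>t. g t * E t) has_vector_derivative g t * (E t * (- 2 * \<i> * l)) + g' t * E t) (at t)"
        by (intro has_vector_derivative_mult gd)
      from has_vector_derivative_divide[OF this, of "- 2 * \<i> * l"]
      have "(G has_vector_derivative (g t * (E t * (- 2 * \<i> * l)) + g' t * E t) / (- 2 * \<i> * l)) (at t)"
        unfolding G_def .
      moreover have "(g t * (E t * (- 2 * \<i> * l)) + g' t * E t) / (- 2 * \<i> * l) = g' t * E t / (- 2 * \<i> * l) + g t * E t"
        using l0 by (simp add: field_simps)
      ultimately show "(G has_vector_derivative g' t * E t / (- 2 * \<i> * l) + g t * E t) (at t within {a..x})"
        by (simp add: has_vector_derivative_at_within)
    qed (use False in simp)
    then have "G x - G a = integral {a..x} (\<lambda>t. g' t * E t / (- 2 * \<i> * l) + g t * E t)"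
      by (simp add: integral_unique)
    also have "\<dots> = integral {a..x} (\<lambda>t. g' t * E t / (- 2 * \<i> * l)) + integral {a..x} (\<lambda>t. g t * E t)"
      using l0 by (intro Henstock_Kurzweil_Integration.integral_add integrable_continuous_real continuous_intros gc gc' Ec) auto
    finally have parts: "integral {a..x} (\<lambda>t. g t * E t) = G x - G a - integral {a..x} (\<lambda>t. g' t * E t / (- 2 * \<i> * l))"
      by (simp add: algebra_simps)
    have GB: "norm (G t) \<le> M * B / (2 * norm l)" if "t \<in> {a..x}" for t
    proof -
      have "norm (g t) * norm (E t) \<le> M * B"
        using M[of t] EB[OF that] that sub \<open>M > 0\<close> by (intro mult_mono) auto
      then show ?thesis unfolding G_def using l0 by (simp add: norm_divide norm_mult divide_right_mono)
    qed
    have "norm (integral {a..x} (\<lambda>t. g' t * E t / (- 2 * \<i> * l))) \<le> M' * B / (2 * norm l) * (x - a)"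
    proof (rule integral_bound)
      show "continuous_on {a..x} (\<lambda>t. g' t * E t / (- 2 * \<i> * l))"
        using l0 by (intro continuous_intros gc' Ec) auto
      show "norm (g' t * E t / (- 2 * \<i> * l)) \<le> M' * B / (2 * norm l)" if "t \<in> {a..x}" for t
      proof -
        have "norm (g' t) * norm (E t) \<le> M' * B"
          using M'[of t] EB[OF that] that sub \<open>M' > 0\<close> by (intro mult_mono) auto
        then show ?thesis using l0 by (simp add: norm_divide norm_mult divide_right_mono)
      qed
    qed (use False in simp)
    also have "\<dots> \<le> M' * B / (2 * norm l) * \<bar>b\<bar>"
      using x a \<open>M' > 0\<close> \<open>B > 0\<close> by (intro mult_left_mono) auto
    finally have "norm (integral {a..x} (\<lambda>t. g t * E t)) \<le> (M * B / (2 * norm l) + M * B / (2 * norm l)) + M' * B / (2 * norm l) * \<bar>b\<bar>"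
      unfolding parts using GB[of x] GB[of a] False
      by (intro order_trans[OF norm_triangle_ineq4] add_mono) (auto intro!: order_trans[OF norm_triangle_ineq4] add_mono)
    also have "\<dots> = (2 * M + \<bar>b\<bar> * M') / norm l / 2 * B" using l0 by (simp add: field_simps)
    also have "\<dots> \<le> e / 2 * B"
    proof -
      have "2 * M + \<bar>b\<bar> * M' \<le> (R - 1) * e" using \<open>e > 0\<close> by (simp add: R_def)
      also have "\<dots> \<le> norm l * e" using l \<open>e > 0\<close> by (intro mult_right_mono) auto
      finally have "(2 * M + \<bar>b\<bar> * M') / norm l \<le> e" using l0 by (simp add: divide_le_eq mult.commute)
      then show ?thesis using \<open>B > 0\<close> by (intro mult_right_mono divide_right_mono) auto
    qed
    finally have 2: "norm (integral {a..x} (\<lambda>t. g t * E t)) \<le> e / 2 * B" .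
    have "norm (integral {0..x} (\<lambda>t. f t * E t)) \<le> e * B"
      unfolding split using norm_triangle_ineq[of "integral {a..x} (\<lambda>t. (f t - g t) * E t)"] 1 2
      by (smt (verit) field_sum_of_halves distrib_right)
    then show ?thesis by (simp add: E_def B_def)
  qed
  then show ?thesis unfolding eventually_at_infinity by blast
qed

section \<open>The iterated amplitudes\<close>

text \<open>
  For \<open>f = q - ip\<close>, \<open>g = q + ip\<close> (cut off to \<open>0\<close> below \<open>a\<close>) and large \<open>n\<close>, the solution with
  initial value \<open>(0, -1)\<close> is given by \<open>u = -i e\<^bsup>i\<lambda>x\<^esup> delay_amp n a f g \<lambda>\<close> and
  \<open>v = i e\<^bsup>-i\<lambda>x\<^esup> delay_amp n a g f (-\<lambda>)\<close>. For \<open>x < 0\<close> the integral is over the empty set.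
\<close>

primrec delay_amp ::
  "nat \<Rightarrow> real \<Rightarrow> (real \<Rightarrow> complex) \<Rightarrow> (real \<Rightarrow> complex) \<Rightarrow> complex \<Rightarrow> real \<Rightarrow> complex" where
  "delay_amp 0 a f g l x = 1"
| "delay_amp (Suc n) a f g l x = 1 - integral {0..x} (\<lambda>t. f t *
     (exp (- (\<i> * l * complex_of_real (2 * t - a))) * delay_amp n a g f (- l) (t - a)))"

text \<open>Negative arguments arise as \<open>t - a\<close>. In the application the value 1 there
  is multiplied by \<open>f t\<close> with t < a, which is 0, so the convention of a vanishing
  delayed term is respected.\<close>

lemma delay_amp_nonpos: "x \<le> 0 \<Longrightarrow> delay_amp n a f g l x = 1"
  by (cases n; cases "x = 0") auto

lemma continuous_on_delay_amp:
  assumes "a \<ge> 0" "b \<ge> 0" "f absolutely_integrable_on {0..b}" "g absolutely_integrable_on {0..b}"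
  shows "continuous_on {..b} (delay_amp n a f g l)"
  using assms(3,4)
proof (induction n arbitrary: f g l)
  case (Suc n)
  have c: "continuous_on {0..b} (\<lambda>t. exp (- (\<i> * l * complex_of_real (2 * t - a))) * delay_amp n a g f (- l) (t - a))"
    using \<open>a \<ge> 0\<close> by (intro continuous_intros continuous_on_compose2[OF Suc.IH[OF Suc.prems(2,1)]]) auto
  have "(\<lambda>t. f t * (exp (- (\<i> * l * complex_of_real (2 * t - a))) * delay_amp n a g f (- l) (t - a))) integrable_on {0..b}"
    by (intro set_lebesgue_integral_eq_integral(1) absolutely_integrable_mult_continuous Suc.prems(1) c)
  then have "continuous_on {0..b} (delay_amp (Suc n) a f g l)"
    by (simp add: continuous_on_diff indefinite_integral_continuous_1)
  \<comment> \<open>The amplitude is constant on the negative axis, so composing with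
    \<open>max 0\<close> carries continuity over to the arguments reached by the delay.\<close>
  then have "continuous_on {..b} (\<lambda>x. delay_amp (Suc n) a f g l (max 0 x))"
    by (rule continuous_on_compose2) (use \<open>b \<ge> 0\<close> in \<open>auto intro: continuous_intros\<close>)
  moreover have "delay_amp (Suc n) a f g l (max 0 x) = delay_amp (Suc n) a f g l x" for x
    using delay_amp_nonpos[of x "Suc n"] delay_amp_nonpos[of 0 "Suc n"] by (auto simp: max_def simp del: delay_amp.simps)
  ultimately show ?case by (simp del: delay_amp.simps)
qed simp

lemma continuous_on_delay_amp_kernel:
  assumes "a \<ge> 0" "b \<ge> 0" "f absolutely_integrable_on {0..b}" "g absolutely_integrable_on {0..b}" "x \<le> b"
  shows "continuous_on {0..x}
      (\<lambda>t. exp (- (\<i> * l * complex_of_real (2 * t - a))) * delay_amp n a f g (- l) (t - a))"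
proof (rule continuous_on_mult)
  show "continuous_on {0..x} (\<lambda>t. exp (- (\<i> * l * complex_of_real (2 * t - a))))"
    by (intro continuous_intros)
  show "continuous_on {0..x} (\<lambda>t. delay_amp n a f g (- l) (t - a))"
    by (rule continuous_on_compose2[OF continuous_on_delay_amp[OF assms(1-4)]])
       (use assms(1,5) in \<open>auto intro: continuous_intros\<close>)
qed

lemma norm_exp_shift_le:
  assumes "norm l \<le> r" "\<bar>s\<bar> \<le> c"
  shows "norm (exp (- (\<i> * l * complex_of_real s))) \<le> exp (r * c)"
proof -
  have "norm (exp (\<i> * (- l) * complex_of_real s)) \<le> exp (\<bar>Im (- l)\<bar> * c)"
    using assms(2) by (rule norm_exp_i_mult_le)
  also have "\<bar>Im (- l)\<bar> * c \<le> r * c"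
    using assms abs_Im_le_cmod[of l] by (intro mult_right_mono) auto
  finally show ?thesis by simp
qed

text \<open>Supplies the locally uniform bound for \<open>holomorphic_on_integral_mult\<close>. The
  disc \<open>cball 0 r\<close> is symmetric, so the same \<open>r\<close> survives the change from
  \<open>l\<close> to \<open>- l\<close> in the recursion.\<close>

lemma delay_amp_bounded:
  assumes "a \<ge> 0" "b \<ge> 0" "f absolutely_integrable_on {0..b}" "g absolutely_integrable_on {0..b}"
  shows "\<exists>K\<ge>0. \<forall>l\<in>cball 0 r. \<forall>x\<in>{..b}. norm (delay_amp n a f g l x) \<le> K"
  using assms(3,4)
proof (induction n arbitrary: f g)
  case 0
  show ?case by (intro exI[of _ 1]) simp
next
  case (Suc n)
  obtain K where "K \<ge> 0" and K: "\<forall>l\<in>cball 0 r. \<forall>x\<in>{..b}. norm (delay_amp n a g f l x) \<le> K"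
    using Suc.IH[OF Suc.prems(2,1)] by blast
  define I where "I = integral {0..b} (\<lambda>t. norm (f t))"
  \<comment> \<open>For t in [0, b] one has |2t - a| <= 2b + a, which bounds the exponential
    factor.\<close>
  define K' where "K' = exp (r * (2 * b + a)) * K"
  have "K' \<ge> 0" using \<open>K \<ge> 0\<close> by (simp add: K'_def)
  have nf: "(\<lambda>t. norm (f t)) integrable_on {0..b}" using Suc.prems(1) by (simp add: absolutely_integrable_on_def)
  have "I \<ge> 0" unfolding I_def by (intro Henstock_Kurzweil_Integration.integral_nonneg nf) simp
  have "norm (delay_amp (Suc n) a f g l x) \<le> 1 + I * K'" if l: "l \<in> cball 0 r" and x: "x \<le> b" for l x
  proof (cases "x < 0")
    case True
    then show ?thesis using delay_amp_nonpos[of x "Suc n"] \<open>I \<ge> 0\<close> \<open>K' \<ge> 0\<close> by simp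
  next
    case False
    have sub: "{0..x} \<subseteq> {0..b}" using x by auto
    note fx = absolutely_integrable_on_subinterval[OF Suc.prems(1) sub]
    have "norm (integral {0..x} (\<lambda>t. f t *
         (exp (- (\<i> * l * complex_of_real (2 * t - a))) * delay_amp n a g f (- l) (t - a))))
       \<le> integral {0..x} (\<lambda>t. norm (f t)) * K'"
    proof (rule norm_integral_mult_le[OF fx continuous_on_delay_amp_kernel[OF assms(1,2) Suc.prems(2,1) x]])
      fix t assume t: "t \<in> {0..x}"
      have "norm (exp (- (\<i> * l * complex_of_real (2 * t - a)))) \<le> exp (r * (2 * b + a))"
        using l t x \<open>a \<ge> 0\<close> by (intro norm_exp_shift_le) auto
      moreover have "norm (delay_amp n a g f (- l) (t - a)) \<le> K"
        using K l t x \<open>a \<ge> 0\<close> by auto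
      ultimately show "norm (exp (- (\<i> * l * complex_of_real (2 * t - a))) * delay_amp n a g f (- l) (t - a)) \<le> K'"
        unfolding norm_mult K'_def by (intro mult_mono) auto
    qed
    also have "\<dots> \<le> I * K'"
      unfolding I_def using nf fx sub \<open>K' \<ge> 0\<close>
      by (intro mult_right_mono integral_subset_le) (auto simp: absolutely_integrable_on_def)
    finally show ?thesis
      unfolding delay_amp.simps by (intro order_trans[OF norm_triangle_ineq4]) simp
  qed
  then show ?case
    using \<open>I \<ge> 0\<close> \<open>K' \<ge> 0\<close> by (intro exI[of _ "1 + I * K'"]) auto
qed

lemma delay_amp_holomorphic:
  assumes "a \<ge> 0" "b \<ge> 0" "f absolutely_integrable_on {0..b}" "g absolutely_integrable_on {0..b}" "x \<le> b"
  shows "(\<lambda>l. delay_amp n a f g l x) holomorphic_on UNIV"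
  using assms(3-5)
proof (induction n arbitrary: f g x)
  case (Suc n)
  define h where "h t l = exp (- (\<i> * l * complex_of_real (2 * t - a))) * delay_amp n a g f (- l) (t - a)" for t l
  show ?case
  proof (cases "x < 0")
    case True
    then show ?thesis using delay_amp_nonpos[of x "Suc n"] by simp
  next
    case False
    have "(\<lambda>l. integral {0..x} (\<lambda>t. f t * h t l)) holomorphic_on UNIV"
    proof (rule holomorphic_on_integral_mult)
      show "f absolutely_integrable_on {0..x}"
        using absolutely_integrable_on_subinterval[OF Suc.prems(1), of 0 x] Suc.prems(3) by auto
      show "h t holomorphic_on UNIV" if "t \<in> {0..x}" for t
      proof -
        have "(\<lambda>l. delay_amp n a g f l (t - a)) holomorphic_on UNIV"
          using that Suc.prems \<open>a \<ge> 0\<close> by (intro Suc.IH) auto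
        from holomorphic_on_compose_gen[OF _ this, of uminus UNIV]
        have "(\<lambda>l. delay_amp n a g f (- l) (t - a)) holomorphic_on UNIV"
          by (simp add: o_def holomorphic_on_minus)
        then show ?thesis unfolding h_def by (intro holomorphic_intros)
      qed
      show "continuous_on {0..x} (\<lambda>t. h t z)" for z
        unfolding h_def by (rule continuous_on_delay_amp_kernel[OF assms(1,2) Suc.prems(2,1,3)])
      show "\<exists>K. \<forall>t\<in>{0..x}. \<forall>z\<in>cball 0 r. norm (h t z) \<le> K" for r
      proof -
        obtain K where "K \<ge> 0" and K: "\<forall>l\<in>cball 0 r. \<forall>x\<in>{..b}. norm (delay_amp n a g f l x) \<le> K"
          using delay_amp_bounded[OF assms(1,2) Suc.prems(2,1)] by blast
        have "norm (h t z) \<le> exp (r * (2 * b + a)) * K" if "t \<in> {0..x}" "z \<in> cball 0 r" for t z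
          unfolding h_def norm_mult
        proof (rule mult_mono)
          show "norm (exp (- (\<i> * z * complex_of_real (2 * t - a)))) \<le> exp (r * (2 * b + a))"
            using that \<open>a \<ge> 0\<close> Suc.prems(3) by (intro norm_exp_shift_le) auto
          show "norm (delay_amp n a g f (- z) (t - a)) \<le> K"
            using K that \<open>a \<ge> 0\<close> Suc.prems(3) by auto
        qed (use \<open>K \<ge> 0\<close> in auto)
        then show ?thesis by blast
      qed
    qed
    then show ?thesis by (simp add: h_def holomorphic_on_diff)
  qed
qed simp

text \<open>Each level of the recursion lowers the argument by at least \<open>a\<close>; after
  \<open>n\<close> levels an argument up to \<open>n * a\<close> has become nonpositive, where all
  iterates equal 1. An iterate that is stable up to pi solves its own integral equation
  there.\<close>

lemma delay_amp_stable:
  assumes "a > 0" "x \<le> real n * a"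
  shows "delay_amp (Suc n) a f g l x = delay_amp n a f g l x"
  using assms(2)
proof (induction n arbitrary: f g l x)
  case 0
  then show ?case using delay_amp_nonpos[of x] by simp
next
  case (Suc n)
  have "delay_amp (Suc n) a g f (- l) (t - a) = delay_amp n a g f (- l) (t - a)" if "t \<in> {0..x}" for t
    using Suc.prems that by (intro Suc.IH) (auto simp: algebra_simps)
  then show ?case
    unfolding delay_amp.simps(2)[of "Suc n" a f g l x] delay_amp.simps(2)[of n a f g l x]
    by (intro arg_cong2[where f = "(-)"] Henstock_Kurzweil_Integration.integral_cong) simp_all
qed

lemma eventually_at_infinity_uminus:
  "eventually P (at_infinity :: 'a::real_normed_vector filter) \<Longrightarrow> eventually (\<lambda>x. P (- x)) at_infinity"
  unfolding eventually_at_infinity by (metis norm_minus_cancel)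

text \<open>The kernel of \<open>delay_amp\<close> can grow exponentially with \<open>l\<close>, so
  the factor exp(i l x) is kept. Replacing the inner amplitude by 1 leaves a Riemann-Lebesgue
  integral. In the correction, the growth over [t, x] and the inductive growth at t - a add up to at
  most exp(|Im l| x), so the bound reproduces itself.\<close>

lemma delay_amp_asymptotics:
  assumes "a \<ge> 0" "b \<ge> 0" "f absolutely_integrable_on {0..b}" "g absolutely_integrable_on {0..b}"
    and "\<And>t. t < a \<Longrightarrow> f t = 0" "\<And>t. t < a \<Longrightarrow> g t = 0" "e > 0"
  shows "\<forall>\<^sub>F l in at_infinity. \<forall>x\<in>{0..b}.
    norm (exp (\<i> * l * of_real x) * (delay_amp n a f g l x - 1)) \<le> e * exp (\<bar>Im l\<bar> * x)"
  using assms(3-7)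
proof (induction n arbitrary: f g e)
  case (Suc n)
  define I where "I = integral {0..b} (\<lambda>t. norm (f t))"
  have nf: "(\<lambda>t. norm (f t)) integrable_on {0..b}" using Suc.prems(1) by (simp add: absolutely_integrable_on_def)
  have "I \<ge> 0" unfolding I_def by (intro Henstock_Kurzweil_Integration.integral_nonneg nf) simp
  \<comment> \<open>A positive substitute for \<open>I\<close>, which may be 0; \<open>e1\<close>
    then satisfies I * e1 <= e/2.\<close>
  define J where "J = I + 1"
  have "J > 0" using \<open>I \<ge> 0\<close> by (simp add: J_def)
  define e1 where "e1 = e / (2 * J)"
  have "e1 > 0" using Suc.prems(5) \<open>J > 0\<close> by (simp add: e1_def)
  have "J * e1 = e / 2" using \<open>J > 0\<close> by (simp add: e1_def)
  then have e1: "I * e1 \<le> e / 2" using \<open>e1 > 0\<close> by (simp add: J_def distrib_right)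
  have 1: "\<forall>\<^sub>F l in at_infinity. \<forall>x\<in>{0..b}.
     norm (integral {0..x} (\<lambda>t. f t * exp (\<i> * l * complex_of_real (x + a - 2 * t)))) \<le> e / 2 * exp (\<bar>Im l\<bar> * x)"
    using Suc.prems(5) by (intro riemann_lebesgue_exp[OF Suc.prems(1) assms(1) Suc.prems(3)]) auto
  have 2: "\<forall>\<^sub>F l in at_infinity. \<forall>x\<in>{0..b}.
    norm (exp (\<i> * (- l) * of_real x) * (delay_amp n a g f (- l) x - 1)) \<le> e1 * exp (\<bar>Im (- l)\<bar> * x)"
    by (rule eventually_at_infinity_uminus[OF Suc.IH[OF Suc.prems(2,1,4,3) \<open>e1 > 0\<close>]])
  from 1 2 show ?case
  proof eventually_elim
    case (elim l)
    show ?case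
    proof
      fix x assume x: "x \<in> {0..b}"
      define B where "B = exp (\<bar>Im l\<bar> * x)"
      have sub: "{0..x} \<subseteq> {0..b}" and xb: "x \<le> b" using x by auto
      note fx = absolutely_integrable_on_subinterval[OF Suc.prems(1) sub]
      define E where "E t = exp (\<i> * l * complex_of_real (x + a - 2 * t))" for t
      define W where "W t = delay_amp n a g f (- l) (t - a)" for t
      have Ec: "continuous_on {0..x} E" unfolding E_def by (intro continuous_intros)
      have Wc: "continuous_on {0..x} W"
        unfolding W_def using x \<open>a \<ge> 0\<close>
        by (intro continuous_on_compose2[OF continuous_on_delay_amp[OF assms(1,2) Suc.prems(2,1)]] continuous_intros) auto
      have Ei: "(\<lambda>t. f t * E t) integrable_on {0..x}" and EWi: "(\<lambda>t. f t * (E t * (W t - 1))) integrable_on {0..x}"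
        by (intro set_lebesgue_integral_eq_integral(1) absolutely_integrable_mult_continuous fx
            continuous_on_mult continuous_on_diff continuous_on_const Ec Wc)+
      have "exp (\<i> * l * of_real x) * (delay_amp (Suc n) a f g l x - 1)
         = - integral {0..x} (\<lambda>t. exp (\<i> * l * of_real x) * (f t *
             (exp (- (\<i> * l * complex_of_real (2 * t - a))) * W t)))"
        by (simp add: W_def)
      also have "(\<lambda>t. exp (\<i> * l * of_real x) * (f t * (exp (- (\<i> * l * complex_of_real (2 * t - a))) * W t)))
         = (\<lambda>t. f t * E t + f t * (E t * (W t - 1)))"
      proof
        fix t
        \<comment> \<open>The phases combine as x - (2t - a) = x + a - 2t, the form in the
          Riemann-Lebesgue lemma.\<close>
        have "E t = exp (\<i> * l * of_real x) * exp (- (\<i> * l * complex_of_real (2 * t - a)))"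
          unfolding E_def by (simp flip: exp_add) (simp add: algebra_simps)
        then show "exp (\<i> * l * of_real x) * (f t * (exp (- (\<i> * l * complex_of_real (2 * t - a))) * W t))
           = f t * E t + f t * (E t * (W t - 1))" by (simp add: algebra_simps)
      qed
      also have "integral {0..x} (\<lambda>t. f t * E t + f t * (E t * (W t - 1)))
         = integral {0..x} (\<lambda>t. f t * E t) + integral {0..x} (\<lambda>t. f t * (E t * (W t - 1)))"
        by (rule Henstock_Kurzweil_Integration.integral_add[OF Ei EWi])
      finally have "norm (exp (\<i> * l * of_real x) * (delay_amp (Suc n) a f g l x - 1))
         \<le> norm (integral {0..x} (\<lambda>t. f t * E t)) + norm (integral {0..x} (\<lambda>t. f t * (E t * (W t - 1))))"
        by (simp only: norm_minus_cancel norm_triangle_ineq)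
      also have "norm (integral {0..x} (\<lambda>t. f t * E t)) \<le> e / 2 * B"
        using elim(1) x by (simp add: E_def B_def)
      also have "norm (integral {0..x} (\<lambda>t. f t * (E t * (W t - 1)))) \<le> integral {0..x} (\<lambda>t. norm (f t) * (e1 * B))"
      proof (rule Henstock_Kurzweil_Integration.integral_norm_bound_integral[OF EWi])
        show "(\<lambda>t. norm (f t) * (e1 * B)) integrable_on {0..x}"
          using fx by (auto simp: absolutely_integrable_on_def intro: integrable_on_mult_left)
        fix t assume t: "t \<in> {0..x}"
        show "norm (f t * (E t * (W t - 1))) \<le> norm (f t) * (e1 * B)"
        proof (cases "t < a")
          \<comment> \<open>The induction hypothesis says nothing at t - a < 0, but there
            \<open>f t\<close> is 0.\<close>
          case True
          then show ?thesis by (simp add: Suc.prems(3))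
        next
          case False
          \<comment> \<open>Splitting x + a - 2t = (x - t) - (t - a) isolates the weight with which
            the induction hypothesis for \<open>- l\<close> speaks about the point t - a.\<close>
          have "E t = exp (\<i> * l * of_real (x - t)) * exp (\<i> * (- l) * of_real (t - a))"
            unfolding E_def by (simp flip: exp_add) (simp add: algebra_simps)
          then have "norm (E t * (W t - 1)) = norm (exp (\<i> * l * of_real (x - t)))
              * norm (exp (\<i> * (- l) * of_real (t - a)) * (W t - 1))"
            by (simp only: norm_mult mult.assoc)
          also have "\<dots> \<le> exp (\<bar>Im l\<bar> * (x - t)) * (e1 * exp (\<bar>Im (- l)\<bar> * (t - a)))"
          proof (rule mult_mono)
            show "norm (exp (\<i> * l * of_real (x - t))) \<le> exp (\<bar>Im l\<bar> * (x - t))"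
              using t by (intro norm_exp_i_mult_le) auto
            show "norm (exp (\<i> * (- l) * of_real (t - a)) * (W t - 1)) \<le> e1 * exp (\<bar>Im (- l)\<bar> * (t - a))"
              unfolding W_def using elim(2) t x False \<open>a \<ge> 0\<close> by (intro elim(2)[rule_format]) auto
          qed auto
          also have "\<dots> = e1 * exp (\<bar>Im l\<bar> * (x - a))"
            by (simp flip: exp_add) (simp add: algebra_simps)
          also have "\<dots> \<le> e1 * B"
            unfolding B_def using \<open>e1 > 0\<close> \<open>a \<ge> 0\<close> by (auto intro!: mult_left_mono)
          finally show ?thesis unfolding norm_mult[of "f t"] by (intro mult_left_mono) auto
        qed
      qed
      also have "integral {0..x} (\<lambda>t. norm (f t) * (e1 * B)) = integral {0..x} (\<lambda>t. norm (f t)) * (e1 * B)"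
        by simp
      also have "\<dots> \<le> I * (e1 * B)"
        unfolding I_def using nf fx sub \<open>e1 > 0\<close>
        by (intro mult_right_mono integral_subset_le) (auto simp: absolutely_integrable_on_def B_def)
      also have "\<dots> \<le> e / 2 * B"
        using mult_right_mono[OF e1, of B] by (simp add: B_def mult.assoc)
      finally show "norm (exp (\<i> * l * of_real x) * (delay_amp (Suc n) a f g l x - 1)) \<le> e * exp (\<bar>Im l\<bar> * x)"
        by (simp add: B_def)
    qed
  qed
qed simp

section \<open>Solutions of the Dirac system with delay\<close>

text \<open>On a bounded interval 1 is integrable, and |f| <= 1 + |f|^2.\<close>

lemma square_integrable_imp_absolutely_integrable:
  assumes "f square_integrable_on {a<..<b}"
  shows "f absolutely_integrable_on {a..b}"
proof -
  have meas: "f \<in> borel_measurable (lebesgue_on {a<..<b})"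
    and sq: "integrable (lebesgue_on {a<..<b}) (\<lambda>x. (norm (f x))\<^sup>2)"
    using assms by (auto simp: square_integrable_on_def)
  have "f absolutely_integrable_on {a<..<b}"
  proof (rule measurable_bounded_by_integrable_imp_absolutely_integrable[OF meas])
    have "(\<lambda>x. (norm (f x))\<^sup>2) integrable_on {a<..<b}"
      by (rule integrable_on_lebesgue_on[OF sq]) simp
    moreover have "(\<lambda>x. 1::real) integrable_on {a<..<b}"
      by (rule integrable_on_const) simp
    ultimately show "(\<lambda>x. 1 + (norm (f x))\<^sup>2) integrable_on {a<..<b}" by (intro integrable_add)
    show "norm (f x) \<le> 1 + (norm (f x))\<^sup>2" for x
    proof -
      have "0 \<le> (norm (f x) - 1)\<^sup>2" by simp
      also have "\<dots> = (norm (f x))\<^sup>2 + 1 - 2 * norm (f x)" by (simp add: power2_diff)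
      finally show ?thesis using norm_ge_zero[of "f x"] by linarith
    qed
  qed simp
  then show ?thesis
    using absolutely_integrable_on_open_interval[of a b f] by simp
qed

text \<open>The cut-off coefficients vanish at every point below \<open>a\<close>, matching the case
  distinction in \<open>dirac_solution\<close>.\<close>

lemma absolutely_integrable_cutoff:
  fixes f :: "real \<Rightarrow> 'a::euclidean_space"
  assumes "f absolutely_integrable_on {b..c}" "b \<le> a"
  shows "(\<lambda>t. if t < a then 0 else f t) absolutely_integrable_on {b..c}"
proof -
  have "f absolutely_integrable_on {a..c}"
    using assms by (intro absolutely_integrable_on_subinterval[OF assms(1)]) auto
  moreover have "(\<lambda>t. indicator {b..c} t *\<^sub>R (if t < a then 0 else f t)) = (\<lambda>t. indicator {a..c} t *\<^sub>R f t)"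
    using assms(2) by (auto simp: indicator_def)
  ultimately show ?thesis unfolding set_integrable_def by simp
qed

lemma bounded_linear_vector_scalar_mult_left:
  "bounded_linear (\<lambda>z::complex. z *s (w :: complex^2))"
  by (simp add: linear_conv_bounded_linear[symmetric] linear_iff vec_eq_iff scaleR_vec_def distrib_right)

lemma bounded_linear_vector_scalar_mult_right:
  "bounded_linear (\<lambda>w :: complex^2. (z::complex) *s w)"
  by (simp add: linear_conv_bounded_linear[symmetric] linear_iff vec_eq_iff distrib_left)

text \<open>Superposition: subtracting a multiple of the explicit solution reduces proportionality
  of solutions to the vanishing of a solution with zero initial value.\<close>

lemma dirac_solution_diff_cmult:
  assumes y: "dirac_solution a p q l y" and z: "dirac_solution a p q l z"
  shows "dirac_solution a p q l (\<lambda>x. y x + c *s z x)"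
  unfolding dirac_solution_def
proof
  show "abs_continuous_on {0..pi} (\<lambda>x. y x + c *s z x)"
    using y z by (intro abs_continuous_on_add abs_continuous_on_bounded_linear[OF _ bounded_linear_vector_scalar_mult_right])
      (auto simp: dirac_solution_def)
  have "AE x in lebesgue. (0 < x \<and> x < pi \<longrightarrow>
      (\<exists>y'. (y has_vector_derivative y') (at x) \<and>
           matB *v y' + (if x < a then 0 else matQ p q x *v y (x - a)) = l *s y x)) \<and>
     (0 < x \<and> x < pi \<longrightarrow>
      (\<exists>y'. (z has_vector_derivative y') (at x) \<and>
           matB *v y' + (if x < a then 0 else matQ p q x *v z (x - a)) = l *s z x))"
    using y z unfolding dirac_solution_def by (intro AE_conjI) blast+
  then show "AE x in lebesgue. 0 < x \<and> x < pi \<longrightarrow>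
      (\<exists>y'. ((\<lambda>x. y x + c *s z x) has_vector_derivative y') (at x) \<and>
           matB *v y' + (if x < a then 0 else matQ p q x *v (y (x - a) + c *s z (x - a))) = l *s (y x + c *s z x))"
  proof (rule AE_mp, intro AE_I2 impI)
    fix x assume "(0 < x \<and> x < pi \<longrightarrow>
      (\<exists>y'. (y has_vector_derivative y') (at x) \<and>
           matB *v y' + (if x < a then 0 else matQ p q x *v y (x - a)) = l *s y x)) \<and>
     (0 < x \<and> x < pi \<longrightarrow>
      (\<exists>y'. (z has_vector_derivative y') (at x) \<and>
           matB *v y' + (if x < a then 0 else matQ p q x *v z (x - a)) = l *s z x))" "0 < x \<and> x < pi"
    then obtain y' z' where d: "(y has_vector_derivative y') (at x)" "(z has_vector_derivative z') (at x)"
      and ey: "matB *v y' + (if x < a then 0 else matQ p q x *v y (x - a)) = l *s y x"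
      and ez: "matB *v z' + (if x < a then 0 else matQ p q x *v z (x - a)) = l *s z x" by blast
    have "((\<lambda>x. y x + c *s z x) has_vector_derivative y' + c *s z') (at x)"
      by (intro has_vector_derivative_add d bounded_linear.has_vector_derivative[OF bounded_linear_vector_scalar_mult_right])
    moreover have "matB *v (y' + c *s z') + (if x < a then 0 else matQ p q x *v (y (x - a) + c *s z (x - a)))
       = (matB *v y' + (if x < a then 0 else matQ p q x *v y (x - a)))
         + c *s (matB *v z' + (if x < a then 0 else matQ p q x *v z (x - a)))"
      by (simp add: matrix_vector_right_distrib vector_scalar_commute vector_add_ldistrib)
    ultimately show "\<exists>y'. ((\<lambda>x. y x + c *s z x) has_vector_derivative y') (at x) \<and>
           matB *v y' + (if x < a then 0 else matQ p q x *v (y (x - a) + c *s z (x - a))) = l *s (y x + c *s z x)"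
      unfolding ey ez by (intro exI[of _ "y' + c *s z'"]) (simp add: vector_add_ldistrib vector_smult_assoc mult.commute)
  qed
qed

lemma matB_mult: "matB *v y = vector [y $ 2, - (y $ 1)]"
  by (simp add: matB_def matrix_vector_mult_def vec_eq_iff forall_2 sum_2)

lemma matQ_mult: "matQ p q x *v y = vector [p x * y $ 1 + q x * y $ 2, q x * y $ 1 - p x * y $ 2]"
  by (simp add: matQ_def matrix_vector_mult_def vec_eq_iff forall_2 sum_2)

lemma has_vector_derivative_exp_linear:
  "((\<lambda>x. exp (c * complex_of_real x)) has_vector_derivative c * exp (c * of_real x)) (at x within S)"
proof -
  have "((\<lambda>z. exp (c * z)) has_field_derivative c * exp (c * of_real x)) (at (of_real x))"
    by (auto intro!: derivative_eq_intros)
  from has_vector_derivative_real_field[OF this] show ?thesis .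
qed

lemma abs_continuous_on_exp_linear: "abs_continuous_on {a..b} (\<lambda>x. exp (c * complex_of_real x))"
  by (rule abs_continuous_on_C1[OF has_vector_derivative_exp_linear]) (intro continuous_intros)

text \<open>With the integrating factor exp(-c x) the product has derivative 0 a.e. and stays
  absolutely continuous, hence is constant.\<close>

lemma abs_continuous_ode_unique:
  fixes w :: "real \<Rightarrow> complex"
  assumes ac: "abs_continuous_on {0..b} w" and "0 \<le> b" and "w 0 = 0"
    and deriv: "AE x in lebesgue. 0 < x \<and> x < b \<longrightarrow> (w has_vector_derivative c * w x) (at x)"
  shows "w b = 0"
proof -
  let ?h = "\<lambda>x. exp (- c * complex_of_real x) * w x"
  have "abs_continuous_on {0..b} ?h"
    by (intro abs_continuous_on_mult abs_continuous_on_exp_linear ac)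
  moreover have "AE x in lebesgue. 0 < x \<and> x < b \<longrightarrow> (?h has_vector_derivative 0) (at x)"
    using deriv
  proof (rule AE_mp, intro AE_I2 impI)
    fix x assume "0 < x \<and> x < b \<longrightarrow> (w has_vector_derivative c * w x) (at x)" "0 < x \<and> x < b"
    then have "(w has_vector_derivative c * w x) (at x)" by simp
    from has_vector_derivative_mult[OF has_vector_derivative_exp_linear[of "- c"] this]
    show "(?h has_vector_derivative 0) (at x)" by (simp add: algebra_simps)
  qed
  ultimately have "?h b = ?h 0" by (rule abs_continuous_on_deriv_zero_imp_constant[OF _ _ \<open>0 \<le> b\<close>])
  then show ?thesis using \<open>w 0 = 0\<close> by simp
qed

text \<open>Method of steps: if y vanishes up to k a, the delayed term vanishes up to (k + 1) a, and
  what remains is the free system, which decouples in the combinations y1 + i y2 and y1 - i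
  y2.\<close>

lemma dirac_solution_zero:
  assumes "a > 0" and y: "dirac_solution a p q l y" and "y 0 = 0" and "x \<in> {0..pi}"
  shows "y x = 0"
proof -
  have "\<forall>x\<in>{0..pi}. x \<le> real k * a \<longrightarrow> y x = 0" for k
  proof (induction k)
    case 0
    then show ?case using \<open>y 0 = 0\<close> by auto
  next
    case (Suc k)
    show ?case
    proof (intro ballI impI)
      fix b assume b: "b \<in> {0..pi}" "b \<le> real (Suc k) * a"
      have ac: "abs_continuous_on {0..b} y"
        using y b(1) by (auto simp: dirac_solution_def intro: abs_continuous_on_subset)
      \<comment> \<open>The sign s = 1 or s = -1 treats both combinations at once; together they
        recover both components.\<close>
      have "y b $ 1 + s * \<i> * y b $ 2 = 0" if s: "s * s = 1" for s :: complex
      proof (rule abs_continuous_ode_unique[of b "\<lambda>x. y x $ 1 + s * \<i> * y x $ 2"])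
        have bl: "bounded_linear (\<lambda>v :: complex^2. v $ 1 + s * \<i> * v $ 2)"
          by (intro bounded_linear_add bounded_linear_const_mult bounded_linear_vec_nth)
        show "abs_continuous_on {0..b} (\<lambda>x. y x $ 1 + s * \<i> * y x $ 2)"
          by (rule abs_continuous_on_bounded_linear[OF ac bl])
        have "AE x in lebesgue. 0 < x \<and> x < pi \<longrightarrow>
          (\<exists>y'. (y has_vector_derivative y') (at x) \<and>
              matB *v y' + (if x < a then 0 else matQ p q x *v y (x - a)) = l *s y x)"
          using y by (simp add: dirac_solution_def)
        then show "AE x in lebesgue. 0 < x \<and> x < b \<longrightarrow> ((\<lambda>x. y x $ 1 + s * \<i> * y x $ 2)
            has_vector_derivative (s * \<i> * l) * (y x $ 1 + s * \<i> * y x $ 2)) (at x)"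
        proof (rule AE_mp, intro AE_I2 impI)
          fix x assume *: "0 < x \<and> x < pi \<longrightarrow>
            (\<exists>y'. (y has_vector_derivative y') (at x) \<and>
              matB *v y' + (if x < a then 0 else matQ p q x *v y (x - a)) = l *s y x)" and x: "0 < x \<and> x < b"
          then obtain y' where d: "(y has_vector_derivative y') (at x)"
            and eq: "matB *v y' + (if x < a then 0 else matQ p q x *v y (x - a)) = l *s y x" using b by auto
          \<comment> \<open>For x >= a the delayed argument x - a lies in [0, k a], where the
            induction hypothesis applies.\<close>
          have "(if x < a then 0 else matQ p q x *v y (x - a)) = 0"
            using Suc.IH[rule_format, of "x - a"] x b \<open>a > 0\<close> by (auto simp: algebra_simps)
          with eq have "matB *v y' = l *s y x" by simp
          then have "y' $ 2 = l * y x $ 1" "y' $ 1 = - (l * y x $ 2)"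
            by (simp_all add: matB_mult vec_eq_iff forall_2 minus_equation_iff[of "y' $ 1"])
          then have "y' $ 1 + s * \<i> * y' $ 2 = s * s * (- l * y x $ 2) + s * \<i> * (l * y x $ 1)"
            using s by simp
          also have "\<dots> = (s * \<i> * l) * (y x $ 1 + s * \<i> * y x $ 2)" by (simp add: algebra_simps)
          finally show "((\<lambda>x. y x $ 1 + s * \<i> * y x $ 2)
            has_vector_derivative (s * \<i> * l) * (y x $ 1 + s * \<i> * y x $ 2)) (at x)"
            using bounded_linear.has_vector_derivative[OF bl d] by simp
        qed
      qed (use b \<open>y 0 = 0\<close> in auto)
      from this[of 1] this[of "-1"] have "y b $ 1 = 0" "y b $ 2 = 0" by (auto simp: add_eq_0_iff)
      then show "y b = 0" by (simp add: vec_eq_iff forall_2)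
    qed
  qed
  moreover obtain k :: nat where "x \<le> real k * a"
    using reals_Archimedean3[OF \<open>a > 0\<close>] by (meson less_imp_le)
  ultimately show ?thesis using assms(4) by blast
qed

text \<open>Variation of constants. The vectors in \<open>y\<close> invert u = y1 + i y2, v = y1 - i
  y2, and the exponential in the kernel of \<open>delay_amp\<close> is the phase that turns the
  inner amplitude at x - a back into the other function at x - a.\<close>

lemma dirac_solution_delay_amp:
  fixes p q :: "real \<Rightarrow> complex" and a :: real and l :: complex and M :: nat
  defines "f \<equiv> \<lambda>t. if t < a then 0 else q t - \<i> * p t"
    and "g \<equiv> \<lambda>t. if t < a then 0 else q t + \<i> * p t"
  defines "u \<equiv> \<lambda>x. - \<i> * (exp (\<i> * l * complex_of_real x) * delay_amp M a f g l x)"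
    and "v \<equiv> \<lambda>x. \<i> * (exp (- (\<i> * l * complex_of_real x)) * delay_amp M a g f (- l) x)"
  defines "y \<equiv> \<lambda>x. u x *s vector [1/2, - \<i>/2] + v x *s vector [1/2, \<i>/2]"
  assumes "a > 0" and f: "f absolutely_integrable_on {0..pi}" and g: "g absolutely_integrable_on {0..pi}"
    and M: "pi \<le> real M * a"
  shows "dirac_solution a p q l y"
proof -
  note zero_pi = order_less_imp_le[OF pi_gt_zero]
  have amp: "abs_continuous_on {0..pi} (delay_amp M a F G k)"
    "AE x in lebesgue. x \<in> {0<..<pi} \<longrightarrow> (delay_amp M a F G k has_vector_derivative
        - (F x * (exp (- (\<i> * k * complex_of_real (2 * x - a))) * delay_amp M a G F (- k) (x - a)))) (at x)"
    if F: "F absolutely_integrable_on {0..pi}" and G: "G absolutely_integrable_on {0..pi}" for F G k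
  proof -
    define h where "h t = F t * (exp (- (\<i> * k * complex_of_real (2 * t - a))) * delay_amp M a G F (- k) (t - a))" for t
    \<comment> \<open>By stability the iterates M and M + 1 agree on [0, pi], so iterate M may stand
      on both sides of the recursion.\<close>
    have eq: "delay_amp M a F G k x = 1 + - integral {0..x} h" if "x \<in> {0..pi}" for x
      using delay_amp_stable[OF \<open>a > 0\<close>, of x M F G k] that M by (simp add: h_def[abs_def])
    have h: "h absolutely_integrable_on {0..pi}"
      unfolding h_def using \<open>a > 0\<close>
      by (intro absolutely_integrable_mult_continuous F continuous_on_delay_amp_kernel[OF _ zero_pi G F]) auto
    have "abs_continuous_on {0..pi} (\<lambda>x. - integral {0..x} h)"
      by (rule abs_continuous_on_bounded_linear[OF abs_continuous_on_indefinite_integral[OF h] bounded_linear_minus[OF bounded_linear_ident]])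
    then have "abs_continuous_on {0..pi} (\<lambda>x. 1 + - integral {0..x} h)"
      by (rule abs_continuous_on_add[OF abs_continuous_on_const])
    moreover have "abs_continuous_on {0..pi} (delay_amp M a F G k)
        \<longleftrightarrow> abs_continuous_on {0..pi} (\<lambda>x. 1 + - integral {0..x} h)"
      by (rule abs_continuous_on_cong) (rule eq)
    ultimately show "abs_continuous_on {0..pi} (delay_amp M a F G k)" by (simp only:)
    have "AE x in lebesgue. x \<in> {0<..<pi} \<longrightarrow> ((\<lambda>x. integral {0..x} h) has_vector_derivative h x) (at x)"
      by (rule indefinite_integral_has_vector_derivative_AE[OF set_lebesgue_integral_eq_integral(1)[OF h]])
    then show "AE x in lebesgue. x \<in> {0<..<pi} \<longrightarrow> (delay_amp M a F G k has_vector_derivative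
        - (F x * (exp (- (\<i> * k * complex_of_real (2 * x - a))) * delay_amp M a G F (- k) (x - a)))) (at x)"
    proof (rule AE_mp, intro AE_I2 impI)
      fix x assume *: "x \<in> {0<..<pi} \<longrightarrow> ((\<lambda>x. integral {0..x} h) has_vector_derivative h x) (at x)" "x \<in> {0<..<pi}"
      then have "((\<lambda>x. 1 + - integral {0..x} h) has_vector_derivative 0 + - h x) (at x)"
        by (intro has_vector_derivative_add has_vector_derivative_minus has_vector_derivative_const) simp
      then have "(delay_amp M a F G k has_vector_derivative 0 + - h x) (at x)"
        by (rule has_vector_derivative_transform_within_open[OF _ open_greaterThanLessThan *(2)]) (simp add: eq)
      then show "(delay_amp M a F G k has_vector_derivative
        - (F x * (exp (- (\<i> * k * complex_of_real (2 * x - a))) * delay_amp M a G F (- k) (x - a)))) (at x)"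
        by (simp add: h_def)
    qed
  qed
  have u: "abs_continuous_on {0..pi} u"
    unfolding u_def
    by (intro abs_continuous_on_mult abs_continuous_on_const amp(1) f g abs_continuous_on_exp_linear)
  have "abs_continuous_on {0..pi} (\<lambda>x. \<i> * (exp (- (\<i> * l) * complex_of_real x) * delay_amp M a g f (- l) x))"
    by (intro abs_continuous_on_mult abs_continuous_on_const amp(1) f g abs_continuous_on_exp_linear)
  then have v: "abs_continuous_on {0..pi} v" by (simp add: v_def)
  show ?thesis
    unfolding dirac_solution_def
  proof
    show "abs_continuous_on {0..pi} y"
      unfolding y_def
      by (intro abs_continuous_on_add abs_continuous_on_bounded_linear[OF u] abs_continuous_on_bounded_linear[OF v]
          bounded_linear_vector_scalar_mult_left)
    have "AE x in lebesgue.
       (x \<in> {0<..<pi} \<longrightarrow> (delay_amp M a f g l has_vector_derivative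
        - (f x * (exp (- (\<i> * l * complex_of_real (2 * x - a))) * delay_amp M a g f (- l) (x - a)))) (at x)) \<and>
       (x \<in> {0<..<pi} \<longrightarrow> (delay_amp M a g f (- l) has_vector_derivative
        - (g x * (exp (- (\<i> * (- l) * complex_of_real (2 * x - a))) * delay_amp M a f g (- (- l)) (x - a)))) (at x))"
      by (intro AE_conjI amp(2) f g)
    then show "AE x in lebesgue. 0 < x \<and> x < pi \<longrightarrow> (\<exists>y'. (y has_vector_derivative y') (at x) \<and>
              matB *v y' + (if x < a then 0 else matQ p q x *v y (x - a)) = l *s y x)"
    proof (rule AE_mp, intro AE_I2 impI)
      fix x assume *: "(x \<in> {0<..<pi} \<longrightarrow> (delay_amp M a f g l has_vector_derivative
        - (f x * (exp (- (\<i> * l * complex_of_real (2 * x - a))) * delay_amp M a g f (- l) (x - a)))) (at x)) \<and>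
       (x \<in> {0<..<pi} \<longrightarrow> (delay_amp M a g f (- l) has_vector_derivative
        - (g x * (exp (- (\<i> * (- l) * complex_of_real (2 * x - a))) * delay_amp M a f g (- (- l)) (x - a)))) (at x))"
        "0 < x \<and> x < pi"
      \<comment> \<open>The exponents add up to the phases of \<open>v (x - a)\<close> and
        \<open>u (x - a)\<close>.\<close>
      have e1: "exp (\<i> * l * of_real x) * exp (- (\<i> * l * complex_of_real (2 * x - a))) = exp (- (\<i> * l * complex_of_real (x - a)))"
        and e2: "exp (- (\<i> * l) * of_real x) * exp (- (\<i> * (- l) * complex_of_real (2 * x - a))) = exp (\<i> * l * complex_of_real (x - a))"
        by (simp_all flip: exp_add add: algebra_simps)
      define A' where "A' = - (f x * (exp (- (\<i> * l * complex_of_real (2 * x - a))) * delay_amp M a g f (- l) (x - a)))"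
      define C' where "C' = - (g x * (exp (- (\<i> * (- l) * complex_of_real (2 * x - a))) * delay_amp M a f g l (x - a)))"
      have dA: "(delay_amp M a f g l has_vector_derivative A') (at x)"
        and dC: "(delay_amp M a g f (- l) has_vector_derivative C') (at x)"
        using * by (simp_all add: A'_def C'_def)
      have "(u has_vector_derivative - \<i> * (exp (\<i> * l * of_real x) * A' + (\<i> * l * exp (\<i> * l * of_real x)) * delay_amp M a f g l x)) (at x)"
        unfolding u_def
        by (intro has_vector_derivative_mult_right has_vector_derivative_mult has_vector_derivative_exp_linear dA)
      moreover have "- \<i> * (exp (\<i> * l * of_real x) * A' + (\<i> * l * exp (\<i> * l * of_real x)) * delay_amp M a f g l x)
         = \<i> * l * u x + f x * v (x - a)"
      proof -
        have "exp (\<i> * l * of_real x) * A'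
          = - (f x * ((exp (\<i> * l * of_real x) * exp (- (\<i> * l * complex_of_real (2 * x - a)))) * delay_amp M a g f (- l) (x - a)))"
          by (simp add: A'_def)
        then show ?thesis unfolding e1 by (simp add: u_def v_def algebra_simps)
      qed
      ultimately have du: "(u has_vector_derivative \<i> * l * u x + f x * v (x - a)) (at x)" by simp
      have "((\<lambda>x. \<i> * (exp (- (\<i> * l) * complex_of_real x) * delay_amp M a g f (- l) x)) has_vector_derivative
          \<i> * (exp (- (\<i> * l) * of_real x) * C' + (- (\<i> * l) * exp (- (\<i> * l) * of_real x)) * delay_amp M a g f (- l) x)) (at x)"
        by (intro has_vector_derivative_mult_right has_vector_derivative_mult has_vector_derivative_exp_linear dC)
      moreover have "\<i> * (exp (- (\<i> * l) * of_real x) * C' + (- (\<i> * l) * exp (- (\<i> * l) * of_real x)) * delay_amp M a g f (- l) x)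
         = - (\<i> * l * v x) + g x * u (x - a)"
      proof -
        have "exp (- (\<i> * l) * of_real x) * C'
          = - (g x * ((exp (- (\<i> * l) * of_real x) * exp (- (\<i> * (- l) * complex_of_real (2 * x - a)))) * delay_amp M a f g l (x - a)))"
          by (simp add: C'_def)
        then show ?thesis unfolding e2 by (simp add: u_def v_def algebra_simps)
      qed
      ultimately have dv: "(v has_vector_derivative - (\<i> * l * v x) + g x * u (x - a)) (at x)" by (simp add: v_def)
      define y' where "y' = (\<i> * l * u x + f x * v (x - a)) *s vector [1/2, - \<i>/2]
         + (- (\<i> * l * v x) + g x * u (x - a)) *s (vector [1/2, \<i>/2] :: complex^2)"
      have "(y has_vector_derivative y') (at x)"
        unfolding y_def y'_def
        by (intro has_vector_derivative_add bounded_linear.has_vector_derivative[OF bounded_linear_vector_scalar_mult_left] du dv)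
      \<comment> \<open>For x < a both sides lose the delayed term, because \<open>f\<close> and
        \<open>g\<close> are cut off at the same point.\<close>
      moreover have "matB *v y' + (if x < a then 0 else matQ p q x *v y (x - a)) = l *s y x"
        by (auto simp: matB_mult matQ_mult vec_eq_iff forall_2 y'_def y_def f_def g_def field_simps)
      ultimately show "\<exists>y'. (y has_vector_derivative y') (at x) \<and>
              matB *v y' + (if x < a then 0 else matQ p q x *v y (x - a)) = l *s y x" by blast
    qed
  qed
qed

section \<open>Zeros of perturbed sine functions\<close>

text \<open>This is (cosh(2 pi y) - cos(2 pi x)) / 2 for z = x + i y, written with |y| so that the
  dominant exponential is visible.\<close>

lemma norm_sin_pi_squared:
  fixes z :: complex
  shows "(norm (sin (of_real pi * z)))\<^sup>2
    = (exp (2 * pi * \<bar>Im z\<bar>) + exp (- (2 * pi * \<bar>Im z\<bar>)) - 2 * cos (2 * pi * Re z)) / 4"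
  by (cases "Im z \<ge> 0") (simp_all add: norm_sin_squared exp_minus mult.assoc)

lemma norm_sin_pi_diff_of_int:
  fixes z :: complex
  shows "norm (sin (of_real pi * (z - of_int n))) = norm (sin (of_real pi * z))"
proof -
  have "cos (2 * pi * (Re z - of_int n)) = cos (2 * pi * Re z)"
    using sin_int_2pin[of n] cos_int_2pin[of n] by (simp add: right_diff_distrib cos_diff)
  then have "(norm (sin (of_real pi * (z - of_int n))))\<^sup>2 = (norm (sin (of_real pi * z)))\<^sup>2"
    by (simp add: norm_sin_pi_squared)
  then show ?thesis by (simp add: power2_eq_iff_nonneg)
qed

lemma sin_pi_eq_0_iff:
  fixes z :: complex
  shows "sin (of_real pi * z) = 0 \<longleftrightarrow> (\<exists>n::int. z = of_int n)"
  by (auto simp: Complex_Transcendental.sin_eq_0)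

text \<open>In the strip |Im z| <= 1, periodicity of the modulus reduces the claim to a compact cell
  without small balls about the zeros, where the minimum is positive. Outside the strip the dominant
  exponential alone gives the bound.\<close>

lemma norm_sin_pi_lower_bound:
  assumes "\<delta> > 0"
  obtains m where "m > 0"
    "\<And>z. (\<And>n::int. norm (z - of_int n) \<ge> \<delta>) \<Longrightarrow> m * exp (pi * \<bar>Im z\<bar>) \<le> norm (sin (of_real pi * z))"
proof -
  \<comment> \<open>The box contains only the integers -1, 0, 1, so removing three balls removes all
    zeros of the sine in it. For large \<open>\<delta>\<close> nothing may be left.\<close>
  define K where "K = cbox (Complex (- 1) (- 1)) (Complex 1 1) - (\<Union>n\<in>{-1, 0, 1::int}. ball (of_int n) \<delta>)"
  have nz: "sin (of_real pi * z) \<noteq> 0" if "z \<in> K" for z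
  proof
    assume "sin (of_real pi * z) = 0"
    then obtain n :: int where n: "z = of_int n" unfolding sin_pi_eq_0_iff by blast
    have "n \<in> {-1, 0, 1}" using that n by (auto simp: K_def in_cbox_complex_iff)
    moreover have "z \<in> ball (of_int n) \<delta>" using n \<open>\<delta> > 0\<close> by simp
    ultimately show False using that by (auto simp: K_def)
  qed
  obtain m0 where "m0 > 0" and m0: "\<And>z. z \<in> K \<Longrightarrow> m0 \<le> norm (sin (of_real pi * z))"
  proof (cases "K = {}")
    case True
    then show ?thesis using that[of 1] by simp
  next
    case False
    have "compact K" unfolding K_def by (intro compact_diff compact_cbox open_UN) auto
    moreover have "continuous_on K (\<lambda>z. norm (sin (of_real pi * z)))" by (intro continuous_intros)
    ultimately obtain w where "w \<in> K" "\<And>z. z \<in> K \<Longrightarrow> norm (sin (of_real pi * w)) \<le> norm (sin (of_real pi * z))"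
      using continuous_attains_inf[OF _ False] by blast
    then show ?thesis using that[of "norm (sin (of_real pi * w))"] nz by simp
  qed
  \<comment> \<open>The factor exp(-pi) offsets exp(pi |Im z|) <= exp(pi) in the strip; 1/4 is the
    constant outside it.\<close>
  define m where "m = min (m0 * exp (- pi)) (1/4)"
  show ?thesis
  proof (rule that)
    show "m > 0" using \<open>m0 > 0\<close> by (simp add: m_def)
    fix z :: complex assume z: "\<And>n::int. norm (z - of_int n) \<ge> \<delta>"
    show "m * exp (pi * \<bar>Im z\<bar>) \<le> norm (sin (of_real pi * z))"
    proof (cases "\<bar>Im z\<bar> \<le> 1")
      case True
      define n where "n = \<lfloor>Re z\<rfloor>"
      have "of_int n \<le> Re z" "Re z < of_int n + 1" unfolding n_def by linarith+
      then have "z - of_int n \<in> cbox (Complex (- 1) (- 1)) (Complex 1 1)"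
        using True by (auto simp: in_cbox_complex_iff abs_le_iff)
      moreover have "z - of_int n \<notin> ball (of_int k) \<delta>" for k
        using z[of "n + k"] by (simp add: dist_norm norm_minus_commute algebra_simps not_less)
      ultimately have "z - of_int n \<in> K" unfolding K_def by blast
      then have "m0 \<le> norm (sin (of_real pi * z))"
        using m0[of "z - of_int n"] norm_sin_pi_diff_of_int[of z n] by simp
      moreover have "m * exp (pi * \<bar>Im z\<bar>) \<le> m0 * exp (- pi) * exp pi"
        using True \<open>m0 > 0\<close> by (intro mult_mono) (auto simp: m_def)
      moreover have "m0 * exp (- pi) * exp pi = m0" by (simp add: exp_minus)
      ultimately show ?thesis by linarith
    next
      case False
      define E where "E = exp (pi * \<bar>Im z\<bar>)"
      have "2 \<le> E"
      proof -
        have "pi * 1 \<le> pi * \<bar>Im z\<bar>" using False by (intro mult_left_mono) auto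
        then have "1 \<le> pi * \<bar>Im z\<bar>" using pi_ge_two by linarith
        then show ?thesis using exp_ge_add_one_self[of "pi * \<bar>Im z\<bar>"] unfolding E_def by linarith
      qed
      have "(E / 4)\<^sup>2 \<le> (norm (sin (of_real pi * z)))\<^sup>2"
      proof -
        have "exp (2 * pi * \<bar>Im z\<bar>) = E\<^sup>2" by (simp add: E_def flip: exp_of_nat_mult)
        moreover have "4 \<le> E\<^sup>2" using mult_mono[OF \<open>2 \<le> E\<close> \<open>2 \<le> E\<close>] \<open>2 \<le> E\<close> by (simp add: power2_eq_square)
        \<comment> \<open>Used with w = E^2, x = E^(-2) and y the cosine: 4 <= w gives w - 2 >=
          w/4.\<close>
        moreover have *: "w / 16 \<le> (w + x - 2 * y) / 4" if "4 \<le> w" "0 \<le> x" "y \<le> 1" for w x y :: real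
          using that by (simp add: field_simps)
        ultimately show ?thesis
          using *[OF _ exp_ge_zero[of "- (2 * pi * \<bar>Im z\<bar>)"] cos_le_one[of "2 * pi * Re z"], of "E\<^sup>2"]
          by (simp only: norm_sin_pi_squared power_divide) simp
      qed
      then have "E / 4 \<le> norm (sin (of_real pi * z))" by (rule power2_le_imp_le) simp
      moreover have "m * E \<le> 1/4 * E" using \<open>2 \<le> E\<close> by (intro mult_right_mono) (auto simp: m_def)
      ultimately show ?thesis unfolding E_def by linarith
    qed
  qed
qed

text \<open>The point \<open>w\<close> shows that \<open>f\<close> is not identically 0, so by the
  identity theorem its zeros are isolated and the order is meaningful everywhere.\<close>

lemma zorder_pos_entire:
  assumes "f holomorphic_on UNIV" "f w \<noteq> 0"
  shows "zorder f z > 0 \<longleftrightarrow> f z = 0"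
proof (rule zorder_pos_iff[OF assms(1)])
  have "\<forall>\<^sub>F w in at z. f w \<noteq> 0 \<and> w \<in> UNIV"
    by (rule non_zero_neighbour_alt[OF assms(1) _ _ _ _ assms(2)]) auto
  then show "\<exists>\<^sub>F w in at z. f w \<noteq> 0"
    by (intro eventually_frequently) (auto elim: eventually_mono)
qed auto

lemma finite_zeros_entire:
  assumes "f holomorphic_on UNIV" "f w \<noteq> 0" "bounded S"
  shows "finite {z \<in> S. f z = 0}"
proof (cases "f constant_on UNIV")
  case True
  then have "{z \<in> S. f z = 0} = {}" using assms(2) by (auto simp: constant_on_def)
  then show ?thesis by (simp only: finite.emptyI)
next
  case False
  have "finite {z \<in> closure S. f z = 0}"
    using assms False by (intro holomorphic_compact_finite_zeros[of f UNIV]) auto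
  then show ?thesis by (rule finite_subset[rotated]) (use closure_subset in auto)
qed

text \<open>\<open>Rouche_theorem\<close> weights orders by winding numbers. For a circle these are
  1 inside and 0 outside, and by the strict inequality no zero lies on the circle.\<close>

lemma Rouche_circle:
  assumes f: "f holomorphic_on UNIV" and g: "g holomorphic_on UNIV" and "r > 0"
    and less: "\<And>z. z \<in> sphere c r \<Longrightarrow> norm (g z - f z) < norm (f z)"
  shows "(\<Sum>p | p \<in> ball c r \<and> g p = 0. zorder g p) = (\<Sum>p | p \<in> ball c r \<and> f p = 0. zorder f p)"
proof -
  have "c + of_real r \<in> sphere c r" using \<open>r > 0\<close> by (simp add: dist_norm)
  from less[OF this] have nz: "f (c + of_real r) \<noteq> 0" "g (c + of_real r) \<noteq> 0" by auto
  \<comment> \<open>A slightly larger ball contains the path and, being bounded, only finitely many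
    zeros.\<close>
  define s where "s = ball c (r + 1)"
  have "bounded s" by (simp add: s_def)
  note fin = finite_zeros_entire[OF f nz(1) this] finite_zeros_entire[OF g nz(2) this]
  have wn1: "winding_number (circlepath c r) p = 1" if "p \<in> ball c r" for p
    using that by (intro winding_number_circlepath) (simp add: dist_norm norm_minus_commute)
  have wn0: "winding_number (circlepath c r) p = 0" if "p \<notin> cball c r" for p
    using that \<open>r > 0\<close> by (intro winding_number_zero_outside[of _ "cball c r"]) auto
  have "(\<Sum>p | p \<in> s \<and> f p + (g p - f p) = 0. winding_number (circlepath c r) p * zorder (\<lambda>p. f p + (g p - f p)) p)
     = (\<Sum>p | p \<in> s \<and> f p = 0. winding_number (circlepath c r) p * zorder f p)"
  proof (rule Rouche_theorem)
    show "f holomorphic_on s" "(\<lambda>p. g p - f p) holomorphic_on s"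
      using f g by (auto intro!: holomorphic_intros intro: holomorphic_on_subset)
    show "path_image (circlepath c r) \<subseteq> s" using \<open>r > 0\<close> by (auto simp: s_def)
    show "\<forall>z\<in>path_image (circlepath c r). norm (g z - f z) < norm (f z)" using less \<open>r > 0\<close> by simp
    show "\<forall>z. z \<notin> s \<longrightarrow> winding_number (circlepath c r) z = 0" using wn0 by (auto simp: s_def)
  qed (use fin in \<open>auto simp: s_def\<close>)
  then have eq: "(\<Sum>p | p \<in> s \<and> g p = 0. winding_number (circlepath c r) p * zorder g p)
     = (\<Sum>p | p \<in> s \<and> f p = 0. winding_number (circlepath c r) p * zorder f p)" by simp
  have red: "(\<Sum>p | p \<in> s \<and> h p = 0. winding_number (circlepath c r) p * zorder h p)
       = of_int (\<Sum>p | p \<in> ball c r \<and> h p = 0. zorder h p)"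
    if "finite {p \<in> s. h p = 0}" "\<And>z. z \<in> sphere c r \<Longrightarrow> h z \<noteq> 0" for h
  proof -
    have "(\<Sum>p | p \<in> s \<and> h p = 0. winding_number (circlepath c r) p * zorder h p)
       = (\<Sum>p | p \<in> ball c r \<and> h p = 0. of_int (zorder h p))"
    proof (rule sum.mono_neutral_cong_right)
      show "\<forall>p\<in>{p. p \<in> s \<and> h p = 0} - {p. p \<in> ball c r \<and> h p = 0}. winding_number (circlepath c r) p * zorder h p = 0"
      proof
        fix p assume "p \<in> {p. p \<in> s \<and> h p = 0} - {p. p \<in> ball c r \<and> h p = 0}"
        then have "p \<notin> ball c r" "p \<notin> sphere c r" using that(2) by auto
        then have "p \<notin> cball c r" by auto
        then show "winding_number (circlepath c r) p * zorder h p = 0" using wn0 by simp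
      qed
    qed (use that wn1 in \<open>auto simp: s_def\<close>)
    then show ?thesis by simp
  qed
  have f0: "f z \<noteq> 0" and g0: "g z \<noteq> 0" if "z \<in> sphere c r" for z
    using less[OF that] by auto
  have "(of_int (\<Sum>p | p \<in> ball c r \<and> g p = 0. zorder g p) :: complex)
     = of_int (\<Sum>p | p \<in> ball c r \<and> f p = 0. zorder f p)"
    by (rule trans[OF red[OF fin(2) g0, symmetric] trans[OF eq red[OF fin(1) f0]]])
  then show ?thesis by (simp only: of_int_eq_iff)
qed

text \<open>The disc of radius R0 + 1/2 about \<open>c\<close> contains just the points
  \<open>pt n\<close> with |n| <= R0. Hence D has 2 R0 + 1 zeros in it, one for each such index, and
  every other index keeps the unique zero near its own \<open>pt n\<close>. Labels inside the disc
  may be assigned arbitrarily, since the asymptotics concern large |n| only.\<close>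

lemma perturbed_sine_zeros:
  fixes D :: "complex \<Rightarrow> complex" and \<kappa> :: complex and c :: real
  assumes D: "D holomorphic_on UNIV" and "\<kappa> \<noteq> 0"
    and bound: "\<And>e. e > 0 \<Longrightarrow> \<forall>\<^sub>F z in at_infinity.
       norm (D z - \<kappa> * sin (of_real pi * (z - of_real c))) \<le> e * exp (pi * \<bar>Im z\<bar>)"
  obtains ev :: "int \<Rightarrow> complex" where "range ev = {z. D z = 0}"
    "\<And>z. D z = 0 \<Longrightarrow> finite {n. ev n = z} \<and> int (card {n. ev n = z}) = zorder D z"
    "\<And>e. e > 0 \<Longrightarrow> \<exists>N. \<forall>n. N \<le> \<bar>n\<bar> \<longrightarrow> norm (ev n - (of_int n + of_real c)) < e"
proof -
  define S where "S z = \<kappa> * sin (of_real pi * (z - of_real c))" for z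
  define pt where "pt n = of_int n + complex_of_real c" for n :: int
  have S: "S holomorphic_on UNIV" unfolding S_def by (intro holomorphic_intros)
  have S0: "S z = 0 \<longleftrightarrow> (\<exists>n. z = pt n)" for z
    using \<open>\<kappa> \<noteq> 0\<close> sin_pi_eq_0_iff[of "z - of_real c"] by (auto simp: S_def pt_def algebra_simps)
  have pt_diff: "norm (pt m - pt n) = \<bar>of_int (m - n)\<bar>" for m n
    by (simp add: pt_def flip: of_int_diff)
  have pt_sep: "norm (pt m - pt n) \<ge> 1" if "m \<noteq> n" for m n
  proof -
    have "1 \<le> \<bar>m - n\<bar>" using that by simp
    then have "(of_int 1 :: real) \<le> of_int \<bar>m - n\<bar>" by (simp only: of_int_le_iff)
    then show ?thesis by (simp add: pt_diff)
  qed
  have zorder_S: "zorder S (pt n) = 1" for n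
  proof (rule zorder_zero_eqI'[where n = 1])
    show "S analytic_on {pt n}" using S analytic_at by blast
    have "(S has_field_derivative \<kappa> * (cos (of_real pi * (pt n - of_real c)) * of_real pi)) (at (pt n))"
      unfolding S_def by (auto intro!: derivative_eq_intros)
    then have "deriv S (pt n) = \<kappa> * (cos (of_real pi * (pt n - of_real c)) * of_real pi)" by (rule DERIV_imp_deriv)
    moreover have "cos (of_real pi * (pt n - of_real c)) \<noteq> 0"
    proof -
      have "sin (of_real pi * (pt n - of_real c)) = 0" by (auto simp: sin_pi_eq_0_iff pt_def)
      then show ?thesis using sin_cos_squared_add[of "of_real pi * (pt n - of_real c)"] by auto
    qed
    ultimately show "(deriv ^^ nat 1) S (pt n) \<noteq> 0" using \<open>\<kappa> \<noteq> 0\<close> by simp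
    show "(deriv ^^ i) S (pt n) = 0" if "i < nat 1" for i using that S0 by auto
  qed simp

  \<comment> \<open>The inequality for Rouche's theorem, at every large point with distance at least
    \<open>\<delta>\<close> from the lattice. The value 1/4 serves the counting, smaller values the
    asymptotics.\<close>
  have away: "\<exists>R. \<forall>z. R \<le> norm z \<and> (\<forall>n. \<delta> \<le> norm (z - pt n)) \<longrightarrow> norm (D z - S z) < norm (S z)"
    if "\<delta> > 0" for \<delta>
  proof -
    obtain m where "m > 0" and m: "\<And>z. (\<And>n::int. norm (z - of_int n) \<ge> \<delta>)
        \<Longrightarrow> m * exp (pi * \<bar>Im z\<bar>) \<le> norm (sin (of_real pi * z))"
      using norm_sin_pi_lower_bound[OF \<open>\<delta> > 0\<close>] by blast
    define e where "e = norm \<kappa> * m / 2"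
    have "e > 0" using \<open>m > 0\<close> \<open>\<kappa> \<noteq> 0\<close> by (simp add: e_def)
    from bound[OF this] obtain R where R: "\<And>z. R \<le> norm z \<Longrightarrow> norm (D z - S z) \<le> e * exp (pi * \<bar>Im z\<bar>)"
      unfolding eventually_at_infinity S_def by blast
    have "norm (D z - S z) < norm (S z)" if "R \<le> norm z" "\<And>n. \<delta> \<le> norm (z - pt n)" for z
    proof -
      have "m * exp (pi * \<bar>Im (z - of_real c)\<bar>) \<le> norm (sin (of_real pi * (z - of_real c)))"
        using that(2) by (intro m) (simp add: pt_def algebra_simps)
      then have "norm \<kappa> * (m * exp (pi * \<bar>Im z\<bar>)) \<le> norm (S z)"
        unfolding S_def norm_mult by (intro mult_left_mono) auto
      moreover have "e * exp (pi * \<bar>Im z\<bar>) < norm \<kappa> * (m * exp (pi * \<bar>Im z\<bar>))"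
        using \<open>m > 0\<close> \<open>\<kappa> \<noteq> 0\<close> by (simp add: e_def)
      ultimately show ?thesis using R[OF that(1)] by linarith
    qed
    then show ?thesis by blast
  qed

  obtain R where R: "\<And>z. R \<le> norm z \<Longrightarrow> (\<And>n. 1/4 \<le> norm (z - pt n)) \<Longrightarrow> norm (D z - S z) < norm (S z)"
    using away[of "1/4"] by auto
  \<comment> \<open>R0 absorbs the shift of the centre: |z - c| >= R0 implies |z| >= R.\<close>
  obtain R0 :: nat where R0: "R + \<bar>c\<bar> + 1 \<le> real R0" using real_arch_simple by blast
  have large: "R \<le> norm z" if "real R0 \<le> norm (z - of_real c)" for z :: complex
    using norm_triangle_ineq4[of z "of_real c"] that R0 by simp
  have norm_pt: "norm (pt n - of_real c) = \<bar>of_int n\<bar>" for n by (simp add: pt_def)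
  have norm_z: "\<bar>norm (z - of_real c) - \<bar>of_int n\<bar>\<bar> \<le> norm (z - pt n)" for z n
    using norm_triangle_ineq3[of "z - of_real c" "pt n - of_real c"] by (simp add: norm_pt)
  have near: "\<exists>n. int R0 < \<bar>n\<bar> \<and> norm (z - pt n) < 1/4"
    if "D z = 0" "z \<notin> ball (of_real c) (real R0 + 1/2)" for z
  proof -
    have z: "real R0 + 1/2 \<le> norm (z - of_real c)" using that(2) by (simp add: dist_norm norm_minus_commute)
    then have "R \<le> norm z" using large[of z] by simp
    moreover have "\<not> norm (D z - S z) < norm (S z)" using \<open>D z = 0\<close> by simp
    ultimately have "\<not> (\<forall>n. 1/4 \<le> norm (z - pt n))" using R by blast
    then obtain n where n: "norm (z - pt n) < 1/4" unfolding not_all not_le by blast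
    have "real R0 < \<bar>of_int n\<bar>" using norm_z[of z n] n z by linarith
    then show ?thesis using n by (intro exI[of _ n]) linarith
  qed

  have on_sphere: "1/4 \<le> norm (z - pt m)" if "z \<in> sphere (pt n) (1/4)" for z n m
  proof (cases "m = n")
    case False
    have "norm (pt m - pt n) \<le> norm (z - pt m) + norm (z - pt n)"
      using norm_triangle_ineq4[of "z - pt n" "z - pt m"] by simp
    moreover have "norm (z - pt n) = 1/4" using that by (simp add: dist_norm norm_minus_commute)
    ultimately show ?thesis using pt_sep[OF False] by linarith
  qed (use that in \<open>simp add: dist_norm norm_minus_commute\<close>)
  \<comment> \<open>The lattice points have integer distances from \<open>c\<close>, so a circle of
    half-integer radius keeps at least 1/2 away from them.\<close>
  have on_big_sphere: "1/4 \<le> norm (z - pt m)" if "z \<in> sphere (of_real c) (real R0 + 1/2)" for z m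
  proof -
    have "norm (z - of_real c) = real R0 + 1/2" using that by (simp add: dist_norm norm_minus_commute)
    moreover have "\<bar>(real R0 + 1/2) - \<bar>of_int m\<bar>\<bar> \<ge> 1/2"
    proof (cases "\<bar>m\<bar> \<le> int R0")
      case True
      then have "\<bar>real_of_int m\<bar> \<le> real R0" by linarith
      then show ?thesis by linarith
    next
      case False
      then have "\<bar>real_of_int m\<bar> \<ge> real R0 + 1" by linarith
      then show ?thesis by linarith
    qed
    ultimately show ?thesis using norm_z[of z m] by simp
  qed
  \<comment> \<open>A point of the big circle at which D is nonzero; it shows that D is not
    identically 0.\<close>
  define w where "w = complex_of_real (c + (real R0 + 1/2))"
  have "dist (complex_of_real c) w = real R0 + 1/2" unfolding w_def dist_of_real by (simp add: dist_real_def)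
  then have "w \<in> sphere (of_real c) (real R0 + 1/2)" "real R0 \<le> norm (w - of_real c)"
    by (simp_all add: dist_norm norm_minus_commute)
  then have "norm (D w - S w) < norm (S w)" by (intro R large on_big_sphere)
  then have w: "D w \<noteq> 0" by auto
  note pos = zorder_pos_entire[OF D w]

  \<comment> \<open>One simple zero near each distant lattice point\<close>
  have single: "\<exists>z. {p. p \<in> ball (pt n) (1/4) \<and> D p = 0} = {z} \<and> zorder D z = 1" if "int R0 < \<bar>n\<bar>" for n
  proof -
    have n: "real R0 + 1 \<le> \<bar>of_int n\<bar>" using that by linarith
    define Z where "Z = {p. p \<in> ball (pt n) (1/4) \<and> D p = 0}"
    have "(\<Sum>p\<in>Z. zorder D p) = (\<Sum>p | p \<in> ball (pt n) (1/4) \<and> S p = 0. zorder S p)"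
      unfolding Z_def
    proof (rule Rouche_circle[OF S D])
      fix z assume z: "z \<in> sphere (pt n) (1/4)"
      then have "norm (z - pt n) = 1/4" by (simp add: dist_norm norm_minus_commute)
      then have "real R0 \<le> norm (z - of_real c)" using norm_z[of z n] n by linarith
      then show "norm (D z - S z) < norm (S z)" by (intro R large on_sphere[OF z])
    qed simp
    also have "{p. p \<in> ball (pt n) (1/4) \<and> S p = 0} = {pt n}"
    proof -
      have "m = n" if "pt m \<in> ball (pt n) (1/4)" for m
        using pt_sep[of n m] that by (cases "m = n") (auto simp: dist_norm)
      then show ?thesis using S0 by auto
    qed
    finally have sum1: "(\<Sum>p\<in>Z. zorder D p) = 1" by (simp add: zorder_S)
    have "finite Z" unfolding Z_def by (rule finite_zeros_entire[OF D w bounded_ball])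
    have pos_Z: "zorder D p \<ge> 1" if "p \<in> Z" for p using pos[of p] that by (simp add: Z_def)
    have "Z \<noteq> {}" using sum1 by auto
    then obtain z where z: "z \<in> Z" by blast
    have split: "(\<Sum>p\<in>Z. zorder D p) = zorder D z + (\<Sum>p\<in>Z - {z}. zorder D p)"
      using \<open>finite Z\<close> z by (rule sum.remove)
    have "int (card (Z - {z})) = (\<Sum>p\<in>Z - {z}. 1)" by simp
    also have "\<dots> \<le> (\<Sum>p\<in>Z - {z}. zorder D p)" by (rule sum_mono) (use pos_Z in auto)
    \<comment> \<open>The orders are at least 1 and sum to 1, which leaves one zero, of order
      1.\<close>
    finally have "card (Z - {z}) = 0" "zorder D z = 1" using split sum1 pos_Z[OF z] by linarith+
    then have "Z - {z} = {}" using \<open>finite Z\<close> by (metis card_0_eq finite_Diff)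
    then have "Z = {z}" using z by blast
    then show ?thesis using \<open>zorder D z = 1\<close> unfolding Z_def by blast
  qed
  then obtain e where e: "\<And>n. int R0 < \<bar>n\<bar> \<Longrightarrow> {p. p \<in> ball (pt n) (1/4) \<and> D p = 0} = {e n}"
    and e1: "\<And>n. int R0 < \<bar>n\<bar> \<Longrightarrow> zorder D (e n) = 1" by metis
  have e_zero: "D (e n) = 0" and e_near: "norm (e n - pt n) < 1/4" if "int R0 < \<bar>n\<bar>" for n
  proof -
    have "e n \<in> {p. p \<in> ball (pt n) (1/4) \<and> D p = 0}" using e[OF that] by simp
    then show "D (e n) = 0" "norm (e n - pt n) < 1/4" by (auto simp: dist_norm norm_minus_commute)
  qed
  have e_eq: "z = e n" if "int R0 < \<bar>n\<bar>" "D z = 0" "norm (z - pt n) < 1/4" for n z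
  proof -
    have "z \<in> {p. p \<in> ball (pt n) (1/4) \<and> D p = 0}" using that by (simp add: dist_norm norm_minus_commute)
    then show ?thesis unfolding e[OF that(1)] by simp
  qed
  have close_unique: "m = n" if "norm (z - pt m) < 1/4" "norm (z - pt n) < 1/4" for z m n
  proof (rule ccontr)
    assume "m \<noteq> n"
    moreover have "norm (pt m - pt n) \<le> norm (z - pt n) + norm (z - pt m)"
      using norm_triangle_ineq4[of "z - pt n" "z - pt m"] by simp
    ultimately show False using pt_sep[of m n] that by linarith
  qed
  have e_out: "e n \<notin> ball (of_real c) (real R0 + 1/2)" if "int R0 < \<bar>n\<bar>" for n
  proof -
    have "real R0 + 1 \<le> \<bar>of_int n\<bar>" using that by linarith
    then show ?thesis using norm_z[of "e n" n] e_near[OF that] by (simp add: dist_norm norm_minus_commute)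
  qed

  \<comment> \<open>Counting and labelling the zeros in the central disc\<close>
  define Z where "Z = {p. p \<in> ball (of_real c) (real R0 + 1/2) \<and> D p = 0}"
  have "finite Z" unfolding Z_def by (rule finite_zeros_entire[OF D w bounded_ball])
  have sumZ: "(\<Sum>p\<in>Z. zorder D p) = 2 * int R0 + 1"
  proof -
    have "(\<Sum>p\<in>Z. zorder D p) = (\<Sum>p | p \<in> ball (of_real c) (real R0 + 1/2) \<and> S p = 0. zorder S p)"
      unfolding Z_def
    proof (rule Rouche_circle[OF S D])
      fix z assume z: "z \<in> sphere (complex_of_real c) (real R0 + 1/2)"
      then have "real R0 \<le> norm (z - of_real c)" by (simp add: dist_norm norm_minus_commute)
      then show "norm (D z - S z) < norm (S z)" by (intro R large on_big_sphere[OF z])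
    qed simp
    also have "{p. p \<in> ball (of_real c) (real R0 + 1/2) \<and> S p = 0} = pt ` {- int R0..int R0}"
    proof -
      have in_ball: "pt n \<in> ball (of_real c) (real R0 + 1/2) \<longleftrightarrow> n \<in> {- int R0..int R0}" for n
      proof -
        have "pt n \<in> ball (of_real c) (real R0 + 1/2) \<longleftrightarrow> \<bar>real_of_int n\<bar> < real R0 + 1/2"
          using norm_pt[of n] by (simp add: dist_norm norm_minus_commute)
        also have "\<dots> \<longleftrightarrow> n \<in> {- int R0..int R0}" by auto
        finally show ?thesis .
      qed
      show ?thesis
      proof (intro equalityI subsetI)
        fix p assume p: "p \<in> {p. p \<in> ball (of_real c) (real R0 + 1/2) \<and> S p = 0}"
        then obtain n where n: "p = pt n" using S0 by blast
        with p have "n \<in> {- int R0..int R0}" using in_ball[of n] by blast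
        with n show "p \<in> pt ` {- int R0..int R0}" by blast
      next
        fix p assume "p \<in> pt ` {- int R0..int R0}"
        then obtain n where n: "p = pt n" "n \<in> {- int R0..int R0}" by blast
        then have "p \<in> ball (of_real c) (real R0 + 1/2)" using in_ball[of n] by blast
        then show "p \<in> {p. p \<in> ball (of_real c) (real R0 + 1/2) \<and> S p = 0}" using n(1) S0 by blast
      qed
    qed
    also have "(\<Sum>p\<in>pt ` {- int R0..int R0}. zorder S p) = (\<Sum>n\<in>{- int R0..int R0}. zorder S (pt n))"
      by (rule sum.reindex_cong[of pt]) (auto simp: inj_on_def pt_def)
    also have "\<dots> = 2 * int R0 + 1" by (simp add: zorder_S)
    finally show ?thesis .
  qed
  define k where "k p = nat (zorder D p)" for p
  have k: "int (k p) = zorder D p" "k p > 0" if "D p = 0" for p using pos[of p] that by (simp_all add: k_def)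
  \<comment> \<open>Pairing each zero p with the numbers below its order encodes multiplicity in a
    plain finite set, which has as many elements as there are indices |n| <= R0. The first component
    of a bijection then repeats p exactly \<open>k p\<close> times.\<close>
  have "int (card (SIGMA p:Z. {..<k p})) = (\<Sum>p\<in>Z. int (k p))"
    using \<open>finite Z\<close> by simp
  also have "\<dots> = (\<Sum>p\<in>Z. zorder D p)" by (rule sum.cong) (auto simp: Z_def k)
  finally have "card (SIGMA p:Z. {..<k p}) = card {- int R0..int R0}" using sumZ by simp
  then obtain h where h: "bij_betw h {- int R0..int R0} (SIGMA p:Z. {..<k p})"
    using finite_same_card_bij[of "{- int R0..int R0}" "SIGMA p:Z. {..<k p}"] \<open>finite Z\<close> by auto
  define ev where "ev n = (if int R0 < \<bar>n\<bar> then e n else fst (h n))" for n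
  have ev_in: "fst (h n) \<in> Z" if "\<not> int R0 < \<bar>n\<bar>" for n
  proof -
    have "n \<in> {- int R0..int R0}" using that by auto
    then have "h n \<in> (SIGMA p:Z. {..<k p})" using bij_betwE[OF h] by blast
    then show ?thesis by (cases "h n") auto
  qed
  show thesis
  proof (rule that[of ev])
    show "range ev = {z. D z = 0}"
    proof (intro equalityI subsetI)
      fix z assume "z \<in> range ev"
      then show "z \<in> {z. D z = 0}" using ev_in e_zero by (auto simp: ev_def Z_def)
    next
      fix z assume "z \<in> {z. D z = 0}"
      then have z: "D z = 0" by simp
      show "z \<in> range ev"
      proof (cases "z \<in> ball (of_real c) (real R0 + 1/2)")
        case True
        then have "(z, 0) \<in> (SIGMA p:Z. {..<k p})" using z k(2)[OF z] by (auto simp: Z_def)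
        then obtain n where "n \<in> {- int R0..int R0}" "h n = (z, 0)"
          using h unfolding bij_betw_def by (metis imageE)
        then have "ev n = z" by (auto simp: ev_def)
        then show ?thesis by blast
      next
        case False
        from near[OF z this] obtain n where n: "int R0 < \<bar>n\<bar>" "norm (z - pt n) < 1/4" by blast
        then have "ev n = z" using e_eq[OF n(1) z n(2)] by (simp add: ev_def)
        then show ?thesis by blast
      qed
    qed
    show "finite {n. ev n = z} \<and> int (card {n. ev n = z}) = zorder D z" if z: "D z = 0" for z
    proof (cases "z \<in> ball (of_real c) (real R0 + 1/2)")
      case True
      have "ev n = z \<longleftrightarrow> n \<in> {- int R0..int R0} \<and> fst (h n) = z" for n
      proof (cases "int R0 < \<bar>n\<bar>")
        case True
        then have "ev n \<noteq> z" using e_out[OF True] \<open>z \<in> ball (of_real c) (real R0 + 1/2)\<close> by (auto simp: ev_def)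
        then show ?thesis using True by auto
      qed (auto simp: ev_def)
      then have "{n. ev n = z} = {n \<in> {- int R0..int R0}. fst (h n) = z}" by blast
      moreover have "bij_betw h {n \<in> {- int R0..int R0}. fst (h n) = z} ({z} \<times> {..<k z})"
      proof (rule bij_betw_subset[OF h, of "{n \<in> {- int R0..int R0}. fst (h n) = z}"])
        have img: "h ` {- int R0..int R0} = (SIGMA p:Z. {..<k p})" using h by (simp add: bij_betw_def)
        have "z \<in> Z" using True z by (simp add: Z_def)
        show "h ` {n \<in> {- int R0..int R0}. fst (h n) = z} = {z} \<times> {..<k z}"
        proof (intro equalityI subsetI)
          fix t assume "t \<in> h ` {n \<in> {- int R0..int R0}. fst (h n) = z}"
          then have "t \<in> (SIGMA p:Z. {..<k p})" "fst t = z" using img by blast+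
          then show "t \<in> {z} \<times> {..<k z}" by (cases t) auto
        next
          fix t assume t: "t \<in> {z} \<times> {..<k z}"
          then have "t \<in> h ` {- int R0..int R0}" unfolding img using \<open>z \<in> Z\<close> by auto
          then obtain n where "n \<in> {- int R0..int R0}" "t = h n" by blast
          then show "t \<in> h ` {n \<in> {- int R0..int R0}. fst (h n) = z}" using t by auto
        qed
      qed auto
      then have "card {n \<in> {- int R0..int R0}. fst (h n) = z} = k z"
        by (simp add: bij_betw_same_card card_cartesian_product)
      moreover have "finite {n \<in> {- int R0..int R0}. fst (h n) = z}"
        by (rule finite_subset[of _ "{- int R0..int R0}"]) auto
      ultimately show ?thesis using k(1)[OF z] by (simp only:)
    next
      case False
      from near[OF z this] obtain n where n: "int R0 < \<bar>n\<bar>" "norm (z - pt n) < 1/4" by blast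
      have zn: "z = e n" using e_eq[OF n(1) z n(2)] .
      have "{n. ev n = z} = {n}"
      proof (intro equalityI subsetI)
        fix m assume "m \<in> {n. ev n = z}"
        then have m: "ev m = z" by simp
        have "int R0 < \<bar>m\<bar>"
        proof (rule ccontr)
          assume *: "\<not> int R0 < \<bar>m\<bar>"
          then have "z \<in> Z" using m ev_in[OF *] by (simp add: ev_def)
          then show False using False by (simp add: Z_def)
        qed
        then have "z = e m" using m by (simp add: ev_def)
        then have "norm (z - pt m) < 1/4" using e_near[OF \<open>int R0 < \<bar>m\<bar>\<close>] by simp
        then show "m \<in> {n}" using close_unique n(2) by blast
      qed (use zn n(1) in \<open>simp add: ev_def\<close>)
      then show ?thesis using e1[OF n(1)] zn by simp
    qed

    \<comment> \<open>Asymptotics of the enumeration\<close>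
    show "\<exists>N. \<forall>n. N \<le> \<bar>n\<bar> \<longrightarrow> norm (ev n - (of_int n + of_real c)) < \<epsilon>" if "\<epsilon> > 0" for \<epsilon>
    proof -
      \<comment> \<open>The bound 1/4 ensures that the lattice point found near \<open>e n\<close>
        can only be \<open>pt n\<close>.\<close>
      define \<delta> where "\<delta> = min \<epsilon> (1/4)"
      have "\<delta> > 0" "\<delta> \<le> \<epsilon>" "\<delta> \<le> 1/4" using that by (auto simp: \<delta>_def)
      obtain R' where R': "\<And>z. R' \<le> norm z \<Longrightarrow> (\<And>n. \<delta> \<le> norm (z - pt n)) \<Longrightarrow> norm (D z - S z) < norm (S z)"
        using away[OF \<open>\<delta> > 0\<close>] by blast
      define N where "N = max (int R0 + 1) \<lceil>R' + \<bar>c\<bar> + 1\<rceil>"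
      have "norm (ev n - (of_int n + of_real c)) < \<epsilon>" if n: "N \<le> \<bar>n\<bar>" for n
      proof -
        have R0n: "int R0 < \<bar>n\<bar>" using n by (auto simp: N_def)
        have "\<lceil>R' + \<bar>c\<bar> + 1\<rceil> \<le> \<bar>n\<bar>" using n by (simp add: N_def)
        then have "R' + \<bar>c\<bar> + 1 \<le> \<bar>of_int n\<bar>" by linarith
        moreover have "norm (e n - of_real c) \<le> norm (e n) + \<bar>c\<bar>"
          using norm_triangle_ineq4[of "e n" "of_real c"] by simp
        ultimately have "R' \<le> norm (e n)" using norm_z[of "e n" n] e_near[OF R0n] by linarith
        \<comment> \<open>At a zero of D the strict inequality fails, so for large n the zero cannot
          be \<open>\<delta>\<close>-far from the whole lattice.\<close>
        moreover have "\<not> norm (D (e n) - S (e n)) < norm (S (e n))" using e_zero[OF R0n] by simp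
        ultimately have "\<not> (\<forall>m. \<delta> \<le> norm (e n - pt m))" using R' by blast
        then obtain m where m: "norm (e n - pt m) < \<delta>" unfolding not_all not_le by blast
        then have "m = n" using close_unique[of "e n" m n] e_near[OF R0n] \<open>\<delta> \<le> 1/4\<close> by linarith
        then show ?thesis using m \<open>\<delta> \<le> \<epsilon>\<close> R0n by (simp add: ev_def pt_def)
      qed
      then show ?thesis by blast
    qed
  qed
qed

section \<open>Asymptotics of the eigenvalues\<close>

theorem theorem2p1:
  fixes N j :: nat and a :: real and p q :: "real \<Rightarrow> complex"
  assumes "N \<ge> 1"
    and "a \<in> {pi / (real N + 1) ..< pi / real N}"
    and "p square_integrable_on {0<..<pi}" and "q square_integrable_on {0<..<pi}"
    and "AE x in lebesgue. x \<in> {0<..<a} \<longrightarrow> p x = 0"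
    and "AE x in lebesgue. x \<in> {0<..<a} \<longrightarrow> q x = 0"
    and "j \<in> {1, 2}"
  shows "infinite (eigenvalues j a p q) \<and>
    (\<exists>ev :: int \<Rightarrow> complex. enumerates_eigenvalues ev j a p q \<and>
       (\<lambda>n. ev n - (of_int n + (1 - of_nat j) / 2)) \<in> o[filtercomap abs at_top](\<lambda>_. 1))"
proof -
  have "0 < pi / (real N + 1)" by simp
  then have "a > 0" using assms(2) unfolding atLeastLessThan_iff by linarith
  then have "a \<ge> 0" by simp
  obtain M :: nat where M: "pi \<le> real M * a"
    using reals_Archimedean3[OF \<open>a > 0\<close>] by (meson less_imp_le)
  define f where "f = (\<lambda>t. if t < a then 0 else q t - \<i> * p t)"
  define g where "g = (\<lambda>t. if t < a then 0 else q t + \<i> * p t)"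
  note pq = square_integrable_imp_absolutely_integrable[OF assms(3)]
    square_integrable_imp_absolutely_integrable[OF assms(4)]
  have ip: "(\<lambda>t. \<i> * p t) absolutely_integrable_on {0..pi}"
    by (rule set_integrable_mult_right) (rule pq(1))
  have f: "f absolutely_integrable_on {0..pi}"
    unfolding f_def using \<open>a \<ge> 0\<close>
    by (intro absolutely_integrable_cutoff set_integral_diff(1) pq ip)
  have g: "g absolutely_integrable_on {0..pi}"
    unfolding g_def using \<open>a \<ge> 0\<close>
    by (intro absolutely_integrable_cutoff set_integral_add(1) pq ip)
  have f0: "f t = 0" and g0: "g t = 0" if "t < a" for t using that by (simp_all add: f_def g_def)
  note zero_pi = order_less_imp_le[OF pi_gt_zero]

  \<comment> \<open>The explicit solution and its uniqueness\<close>
  define u where "u l x = - \<i> * (exp (\<i> * l * complex_of_real x) * delay_amp M a f g l x)" for l x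
  define v where "v l x = \<i> * (exp (- (\<i> * l * complex_of_real x)) * delay_amp M a g f (- l) x)" for l x
  define y where "y l x = u l x *s vector [1/2, - \<i>/2] + v l x *s (vector [1/2, \<i>/2] :: complex^2)" for l x
  have sol: "dirac_solution a p q l (y l)" for l
    unfolding y_def[abs_def] u_def v_def f_def g_def
    by (rule dirac_solution_delay_amp[OF \<open>a > 0\<close> f[unfolded f_def] g[unfolded g_def] M])
  have y0: "y l 0 = vector [0, - 1]" for l
  proof -
    have "u l 0 = - \<i>" "v l 0 = \<i>" using delay_amp_nonpos[of 0] by (simp_all add: u_def v_def)
    then show ?thesis by (simp add: y_def vec_eq_iff forall_2)
  qed
  have unique: "w x = c *s y l x"
    if "dirac_solution a p q l w" "w 0 = c *s y l 0" "x \<in> {0..pi}" for w c l x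
  proof -
    have "w 0 + (- c) *s y l 0 = 0" using that(2) by (simp add: vec_eq_iff)
    then have "w x + (- c) *s y l x = 0"
      by (rule dirac_solution_zero[OF \<open>a > 0\<close> dirac_solution_diff_cmult[OF that(1) sol] _ that(3)])
    then show ?thesis by (simp add: vec_eq_iff)
  qed
  \<comment> \<open>\<open>SOME\<close> has a witness in \<open>y l\<close>, and uniqueness makes
    the chosen solution agree with it on [0, pi].\<close>
  have S: "dirac_solution a p q l (dirac_S a p q l) \<and> dirac_S a p q l 0 = vector [0, - 1]" for l
    unfolding dirac_S_def
    by (rule someI[where P = "\<lambda>y. dirac_solution a p q l y \<and> y 0 = vector [0, - 1]", OF conjI[OF sol y0]])
  have S_eq: "dirac_S a p q l x = y l x" if "x \<in> {0..pi}" for l x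
    using unique[of l "dirac_S a p q l" 1 x] S[of l] y0[of l] that by simp
  have char_eq: "char_fun j a p q l = y l pi $ of_nat j" for l
    unfolding char_fun_def by (simp add: S_eq)

  \<comment> \<open>Eigenvalues as zeros of the characteristic function\<close>
  have eig: "eigenvalues j a p q = {l. char_fun j a p q l = 0}"
  proof (intro equalityI subsetI)
    fix l assume "l \<in> eigenvalues j a p q"
    then obtain w :: "real \<Rightarrow> complex^2" and x where w: "dirac_solution a p q l w" "w 0 $ 1 = 0" "w pi $ of_nat j = 0"
      and x: "x \<in> {0..pi}" "w x \<noteq> 0" by (auto simp: eigenvalues_def)
    \<comment> \<open>Since \<open>y l 0\<close> is (0, -1), a solution with vanishing first
      component at 0 is c times \<open>y l\<close>; c is nonzero because the eigenfunction is not
      identically 0.\<close>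
    define c where "c = - (w 0 $ 2)"
    have "w 0 = c *s y l 0" using w(2) by (simp add: y0 c_def vec_eq_iff forall_2)
    note un = unique[OF w(1) this]
    have "c \<noteq> 0" using un[OF x(1)] x(2) by (auto simp: vec_eq_iff)
    moreover have "c * y l pi $ of_nat j = 0" using un[of pi] w(3) by simp
    ultimately show "l \<in> {l. char_fun j a p q l = 0}" by (simp add: char_eq)
  next
    fix l assume "l \<in> {l. char_fun j a p q l = 0}"
    then have "y l pi $ of_nat j = 0" by (simp add: char_eq)
    moreover have "y l 0 \<noteq> 0" "y l 0 $ 1 = 0" by (simp_all add: y0 vec_eq_iff forall_2)
    moreover have "(0::real) \<in> {0..pi}" by simp
    ultimately show "l \<in> eigenvalues j a p q" unfolding eigenvalues_def using sol[of l] by blast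
  qed

  \<comment> \<open>Holomorphy in the spectral parameter\<close>
  have "(\<lambda>l. delay_amp M a g f l pi) holomorphic_on UNIV"
    using \<open>a \<ge> 0\<close> by (intro delay_amp_holomorphic[OF _ zero_pi g f]) auto
  from holomorphic_on_compose_gen[OF _ this, of uminus UNIV]
  have hol2: "(\<lambda>l. delay_amp M a g f (- l) pi) holomorphic_on UNIV"
    by (simp add: o_def holomorphic_on_minus)
  have hol1: "(\<lambda>l. delay_amp M a f g l pi) holomorphic_on UNIV"
    using \<open>a \<ge> 0\<close> by (intro delay_amp_holomorphic[OF _ zero_pi f g]) auto
  have huv: "(\<lambda>l. u l pi) holomorphic_on UNIV" "(\<lambda>l. v l pi) holomorphic_on UNIV"
    unfolding u_def v_def by (intro holomorphic_intros hol1 hol2)+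
  have D_hol: "char_fun j a p q holomorphic_on UNIV"
  proof -
    have "char_fun j a p q = (\<lambda>l. u l pi * (vector [1/2, - \<i>/2] :: complex^2) $ of_nat j
        + v l pi * (vector [1/2, \<i>/2] :: complex^2) $ of_nat j)"
      by (rule ext) (simp add: char_eq y_def)
    then show ?thesis by (simp only:) (intro holomorphic_intros huv)
  qed

  \<comment> \<open>Comparison with the unperturbed characteristic function\<close>
  define c where "c = (1 - real j) / 2"
  \<comment> \<open>For j = 1 the shift is 0 and the free function is sin(pi l). For j = 2 the shift
    is -1/2 and sin(pi (l + 1/2)) = cos(pi l), so the sign -1 gives -cos(pi l).\<close>
  define \<kappa> :: complex where "\<kappa> = (if j = 1 then 1 else - 1)"
  have bound: "\<forall>\<^sub>F l in at_infinity.
       norm (char_fun j a p q l - \<kappa> * sin (of_real pi * (l - of_real c))) \<le> e * exp (pi * \<bar>Im l\<bar>)"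
    if "e > 0" for e
  proof -
    have 1: "\<forall>\<^sub>F l in at_infinity. \<forall>x\<in>{0..pi}.
        norm (exp (\<i> * l * of_real x) * (delay_amp M a f g l x - 1)) \<le> e * exp (\<bar>Im l\<bar> * x)"
      by (rule delay_amp_asymptotics[OF \<open>a \<ge> 0\<close> zero_pi f g f0 g0 that])
    have 2: "\<forall>\<^sub>F l in at_infinity. \<forall>x\<in>{0..pi}.
        norm (exp (\<i> * (- l) * of_real x) * (delay_amp M a g f (- l) x - 1)) \<le> e * exp (\<bar>Im (- l)\<bar> * x)"
      by (rule eventually_at_infinity_uminus[OF delay_amp_asymptotics[OF \<open>a \<ge> 0\<close> zero_pi g f g0 f0 that]])
    from 1 2 show ?thesis
    proof eventually_elim
      case (elim l)
      define U where "U = exp (\<i> * l * of_real pi) * (delay_amp M a f g l pi - 1)"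
      define V where "V = exp (- (\<i> * l * of_real pi)) * (delay_amp M a g f (- l) pi - 1)"
      have UV: "norm U \<le> e * exp (pi * \<bar>Im l\<bar>)" "norm V \<le> e * exp (pi * \<bar>Im l\<bar>)"
        using elim(1)[rule_format, of pi] elim(2)[rule_format, of pi] by (simp_all add: U_def V_def mult.commute)
      have u: "u l pi = - \<i> * (exp (\<i> * l * of_real pi) + U)" and v: "v l pi = \<i> * (exp (- (\<i> * l * of_real pi)) + V)"
        by (simp_all add: u_def v_def U_def V_def algebra_simps)
      have "char_fun j a p q l - \<kappa> * sin (of_real pi * (l - of_real c))
         = (if j = 1 then - \<i> / 2 * (U - V) else - 1 / 2 * (U + V))"
      proof (cases "j = 1")
        case True
        have "sin (of_real pi * (l - of_real c)) = - \<i> / 2 * (exp (\<i> * l * of_real pi) - exp (- (\<i> * l * of_real pi)))"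
          using True by (simp add: c_def sin_exp_eq field_simps)
        moreover have "char_fun j a p q l = 1 / 2 * (u l pi + v l pi)"
          unfolding char_eq by (simp add: True y_def)
        moreover have "\<kappa> = 1" by (simp add: \<kappa>_def True)
        ultimately show ?thesis by (simp only: u v if_P[OF True]) (simp add: field_simps)
      next
        case False
        then have j: "j = 2" using assms(7) by simp
        have "sin (of_real pi * (l - of_real c)) = cos (of_real pi * l)"
          by (simp add: j c_def distrib_left sin_add)
        also have "\<dots> = 1 / 2 * (exp (\<i> * l * of_real pi) + exp (- (\<i> * l * of_real pi)))"
          by (simp add: cos_exp_eq field_simps)
        finally have "sin (of_real pi * (l - of_real c)) = 1 / 2 * (exp (\<i> * l * of_real pi) + exp (- (\<i> * l * of_real pi)))" .
        moreover have "char_fun j a p q l = \<i> / 2 * (v l pi - u l pi)"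
          unfolding char_eq by (simp add: j y_def algebra_simps)
        moreover have "\<kappa> = - 1" by (simp add: \<kappa>_def j)
        ultimately show ?thesis by (simp only: u v if_not_P[OF False]) (simp add: field_simps)
      qed
      also have "norm \<dots> \<le> 1 / 2 * (norm U + norm V)"
        using norm_triangle_ineq[of U V] norm_triangle_ineq4[of U V] by (simp add: norm_mult norm_divide)
      also have "\<dots> \<le> e * exp (pi * \<bar>Im l\<bar>)" using UV by simp
      finally show ?case .
    qed
  qed

  \<comment> \<open>Enumeration of the eigenvalues\<close>
  have "\<kappa> \<noteq> 0" by (simp add: \<kappa>_def)
  obtain ev :: "int \<Rightarrow> complex" where ev: "range ev = {z. char_fun j a p q z = 0}"
    "\<And>z. char_fun j a p q z = 0 \<Longrightarrow> finite {n. ev n = z} \<and> int (card {n. ev n = z}) = zorder (char_fun j a p q) z"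
    "\<And>e. e > 0 \<Longrightarrow> \<exists>N. \<forall>n. N \<le> \<bar>n\<bar> \<longrightarrow> norm (ev n - (of_int n + of_real c)) < e"
    using perturbed_sine_zeros[OF D_hol \<open>\<kappa> \<noteq> 0\<close> bound] by blast
  have "infinite (eigenvalues j a p q)"
  proof
    \<comment> \<open>Every value of \<open>ev\<close> is taken finitely often, so finitely many
      eigenvalues would make the index set of all integers finite.\<close>
    assume "finite (eigenvalues j a p q)"
    then have "finite (\<Union>l\<in>eigenvalues j a p q. {n. ev n = l})" using ev(2) by (simp add: eig)
    moreover have "(\<Union>l\<in>eigenvalues j a p q. {n. ev n = l}) = UNIV" using ev(1) by (auto simp: eig)
    ultimately show False by (simp add: infinite_UNIV_int)
  qed
  moreover have "enumerates_eigenvalues ev j a p q"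
    using ev(1,2) by (simp add: enumerates_eigenvalues_def eig)
  moreover have "(\<lambda>n. ev n - (of_int n + (1 - of_nat j) / 2)) \<in> o[filtercomap abs at_top](\<lambda>_. 1)"
  proof (rule landau_o.smallI)
    fix e :: real assume "e > 0"
    have "(1 - of_nat j) / 2 = complex_of_real c" by (simp add: c_def)
    then show "\<forall>\<^sub>F n in filtercomap abs at_top. norm (ev n - (of_int n + (1 - of_nat j) / 2)) \<le> e * norm (1 :: complex)"
      using ev(3)[OF \<open>e > 0\<close>] unfolding eventually_filtercomap_at_top_linorder
      by (metis less_imp_le mult.right_neutral norm_one)
  qed
  ultimately show ?thesis by blast
qed

end
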